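(* Let $\mathcal{A}$ be a finite alphabet and let $X\subseteq\mathcal{A}^{\mathbb{Z}}$ be a subshift such that $(X,\sigma)$ is topologically transitive and $X$ has subquadratic growth, i.e. $\liminf_{n\to\infty} P_X(n)/n^2=0$. Let $H$ be the subgroup of $\mathrm{Aut}(X)$ generated by the shift $\sigma$. Then the quotient group $\mathrm{Aut}(X)/H$ is a periodic group, i.e. every element of $\mathrm{Aut}(X)/H$ has finite order.
   Context: $\mathcal{A}$ is a finite set with the discrete topology and $\mathcal{A}^{\mathbb{Z}}$ has the product topology. The shift $\sigma\colon\mathcal{A}^{\mathbb{Z}}\to\mathcal{A}^{\mathbb{Z}}$ is $(\sigma x)(i)=x(i+1)$. A subshift (or shift) is a closed set $X\subseteq\mathcal{A}^{\mathbb{Z}}$ that is $\sigma$-invariant ($\sigma X=X$). $\mathrm{Aut}(X)$ is the group (under composition) of all homeomorphisms $\varphi\colon X\to X$ with $\varphi\circ\sigma=\sigma\circ\varphi$; the restriction of $\sigma$ to $X$ is an element of $\mathrm{Aut}(X)$, and $H=\{\sigma^n : n\in\mathbb{Z}\}$ is central, hence normal, in $\mathrm{Aut}(X)$. The system $(X,\sigma)$ is topologically transitive if for all nonempty (relatively) open $U,V\subseteq X$ there is $n\in\mathbb{Z}$ with $\sigma^n(U)\cap V\neq\emptyset$. For $n\geq 1$, the block complexity $P_X(n)$ is the number of words $\beta\in\mathcal{A}^{\{0,\dots,n-1\}}$ for which there is $x\in X$ with $x(i)=\beta(i)$ for all $0\leq i<n$. *)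

theory Defs
  imports "HOL-Analysis.Analysis" "HOL-Algebra.Generated_Groups"
begin

definition full_shift :: "'a set \<Rightarrow> (int \<Rightarrow> 'a) topology" where
  "full_shift A = product_topology (\<lambda>_. discrete_topology A) UNIV"

definition shift :: "(int \<Rightarrow> 'a) \<Rightarrow> int \<Rightarrow> 'a" where
  "shift x = (\<lambda>i. x (i + 1))"

definition shift_pow :: "int \<Rightarrow> (int \<Rightarrow> 'a) \<Rightarrow> int \<Rightarrow> 'a" where
  "shift_pow n = (if 0 \<le> n then shift ^^ nat n else (inv_into UNIV shift) ^^ nat (- n))"

definition subshift :: "'a set \<Rightarrow> (int \<Rightarrow> 'a) set \<Rightarrow> bool" where
  "subshift A X \<longleftrightarrow> closedin (full_shift A) X \<and> shift ` X = X"

abbreviation subshift_topology :: "'a set \<Rightarrow> (int \<Rightarrow> 'a) set \<Rightarrow> (int \<Rightarrow> 'a) topology" where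
  "subshift_topology A X \<equiv> subtopology (full_shift A) X"

definition transitive_shift :: "'a set \<Rightarrow> (int \<Rightarrow> 'a) set \<Rightarrow> bool" where
  "transitive_shift A X \<longleftrightarrow>
     (\<forall>U V. openin (subshift_topology A X) U \<and> U \<noteq> {} \<and>
            openin (subshift_topology A X) V \<and> V \<noteq> {} \<longrightarrow>
            (\<exists>n::int. shift_pow n ` U \<inter> V \<noteq> {}))"

definition block_complexity :: "'a set \<Rightarrow> (int \<Rightarrow> 'a) set \<Rightarrow> nat \<Rightarrow> nat" where
  "block_complexity A X n =
     card {\<beta> \<in> {0..<n} \<rightarrow>\<^sub>E A. \<exists>x\<in>X. \<forall>i<n. x (int i) = \<beta> i}"

text \<open>The liminf is taken in the extended reals, where it always exists; the junk value of the
  quotient at \<open>n = 0\<close> does not affect it.\<close>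
definition subquadratic_growth :: "'a set \<Rightarrow> (int \<Rightarrow> 'a) set \<Rightarrow> bool" where
  "subquadratic_growth A X \<longleftrightarrow>
     liminf (\<lambda>n. ereal (real (block_complexity A X n) / (real n)\<^sup>2)) = 0"

text \<open>A map \<open>X \<rightarrow> X\<close> is represented by the total function that is \<open>undefined\<close> outside \<open>X\<close>, so that
  equality of group elements is equality of maps on \<open>X\<close>.\<close>
definition Aut :: "'a set \<Rightarrow> (int \<Rightarrow> 'a) set \<Rightarrow> ((int \<Rightarrow> 'a) \<Rightarrow> (int \<Rightarrow> 'a)) monoid" where
  "Aut A X =
     \<lparr>carrier = {\<phi> \<in> extensional X.
         homeomorphic_map (subshift_topology A X) (subshift_topology A X) \<phi> \<and>
         (\<forall>x\<in>X. \<phi> (shift x) = shift (\<phi> x))},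
      mult = compose X,
      one = (\<lambda>x\<in>X. x)\<rparr>"

definition shift_subgroup :: "'a set \<Rightarrow> (int \<Rightarrow> 'a) set \<Rightarrow> ((int \<Rightarrow> 'a) \<Rightarrow> (int \<Rightarrow> 'a)) set" where
  "shift_subgroup A X = generate (Aut A X) {restrict shift X}"

definition periodic_group :: "('g, 'b) monoid_scheme \<Rightarrow> bool" where
  "periodic_group G \<longleftrightarrow>
     group G \<and> (\<forall>g\<in>carrier G. \<exists>n::nat. n > 0 \<and> g [^]\<^bsub>G\<^esub> n = \<one>\<^bsub>G\<^esub>)"

lemma bij_shift: "bij shift"
  by (rule o_bij[where g = "\<lambda>x i. x (i - 1)"]) (auto simp: shift_def fun_eq_iff)

lemma inv_shift: "inv_into UNIV shift x = (\<lambda>i. x (i - 1))"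
  by (rule inv_f_eq) (use bij_shift in \<open>auto simp: bij_def shift_def\<close>)

lemma shift_inv_shift: "inv_into UNIV shift (shift x) = x" "shift (inv_into UNIV shift x) = x"
  by (simp_all add: inv_shift) (simp_all add: shift_def)

lemma shift_pow_apply: "shift_pow n x = (\<lambda>i. x (i + n))"
proof -
  have 1: "(shift ^^ k) x = (\<lambda>i. x (i + int k))" for k
    by (induction k) (auto simp: shift_def fun_eq_iff algebra_simps)
  have 2: "((inv_into UNIV shift) ^^ k) x = (\<lambda>i. x (i - int k))" for k
    by (induction k) (auto simp: inv_shift fun_eq_iff algebra_simps)
  show ?thesis
    by (auto simp: shift_pow_def 1 2)
qed

lemma topspace_full_shift: "topspace (full_shift A) = (UNIV \<rightarrow>\<^sub>E A)"
  by (simp add: full_shift_def)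

lemma topspace_subshift_topology:
  assumes "subshift A X" shows "topspace (subshift_topology A X) = X"
  using assms closedin_subset by (fastforce simp: subshift_def)

lemma continuous_map_reindex:
  "continuous_map (full_shift A) (full_shift A) (\<lambda>x i. x (f i))"
  unfolding full_shift_def
  by (subst continuous_map_componentwise) (auto intro: continuous_map_product_projection)

lemma restrict_shift_in_Aut:
  assumes X: "subshift A X" shows "restrict shift X \<in> carrier (Aut A X)"
proof -
  have sX: "shift x \<in> X" if "x \<in> X" for x
    using X that by (auto simp: subshift_def)
  have iX: "inv_into UNIV shift x \<in> X" if x: "x \<in> X" for x
  proof -
    obtain y where "y \<in> X" "x = shift y"
      using X x by (auto simp: subshift_def)
    then show ?thesis
      by (simp add: shift_inv_shift)
  qed
  have c1: "continuous_map (full_shift A) (full_shift A) shift"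
    using continuous_map_reindex[of A "\<lambda>i. i + 1"] by (simp add: shift_def[abs_def])
  have c2: "continuous_map (full_shift A) (full_shift A) (inv_into UNIV shift)"
    using continuous_map_reindex[of A "\<lambda>i. i - 1"] by (simp add: inv_shift[abs_def])
  have "homeomorphic_maps (subshift_topology A X) (subshift_topology A X) shift (inv_into UNIV shift)"
    unfolding homeomorphic_maps_def
    using c1 c2 sX iX
    by (auto simp: continuous_map_in_subtopology continuous_map_from_subtopology shift_inv_shift)
  then have "homeomorphic_map (subshift_topology A X) (subshift_topology A X) shift"
    using homeomorphic_map_maps by blast
  then have "homeomorphic_map (subshift_topology A X) (subshift_topology A X) (restrict shift X)"
    by (rule homeomorphic_map_eq) (simp add: topspace_subshift_topology[OF X])
  then show ?thesis
    using sX by (auto simp: Aut_def)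
qed

lemma group_Aut:
  assumes X: "subshift A X" shows "group (Aut A X)"
proof -
  let ?T = "subshift_topology A X"
  note top = topspace_subshift_topology[OF X]
  have sX: "shift x \<in> X" if "x \<in> X" for x
    using X that by (auto simp: subshift_def)
  have maps: "\<phi> x \<in> X" if "homeomorphic_map ?T ?T \<phi>" "x \<in> X" for \<phi> x
    using homeomorphic_imp_surjective_map[OF that(1)] that(2) top by auto
  show ?thesis
  proof (rule groupI)
    fix \<phi> \<psi> assume f: "\<phi> \<in> carrier (Aut A X)" and g: "\<psi> \<in> carrier (Aut A X)"
    then have h: "homeomorphic_map ?T ?T \<phi>" "homeomorphic_map ?T ?T \<psi>"
      by (auto simp: Aut_def)
    have "homeomorphic_map ?T ?T (\<phi> \<circ> \<psi>)"
      using homeomorphic_map_compose[OF h(2) h(1)] .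
    then have "homeomorphic_map ?T ?T (compose X \<phi> \<psi>)"
      by (rule homeomorphic_map_eq) (simp add: top compose_def)
    then show "\<phi> \<otimes>\<^bsub>Aut A X\<^esub> \<psi> \<in> carrier (Aut A X)"
      using f g maps h sX by (auto simp: Aut_def compose_def)
  next
    have "homeomorphic_map ?T ?T (\<lambda>x. x)"
      using homeomorphic_map_id[of ?T ?T] by (simp add: id_def)
    then have "homeomorphic_map ?T ?T (\<lambda>x\<in>X. x)"
      by (rule homeomorphic_map_eq) (simp add: top)
    then show "\<one>\<^bsub>Aut A X\<^esub> \<in> carrier (Aut A X)"
      using sX by (auto simp: Aut_def)
  next
    fix \<phi> \<psi> \<theta>
    assume "\<phi> \<in> carrier (Aut A X)" "\<psi> \<in> carrier (Aut A X)" "\<theta> \<in> carrier (Aut A X)"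
    then show "\<phi> \<otimes>\<^bsub>Aut A X\<^esub> \<psi> \<otimes>\<^bsub>Aut A X\<^esub> \<theta> = \<phi> \<otimes>\<^bsub>Aut A X\<^esub> (\<psi> \<otimes>\<^bsub>Aut A X\<^esub> \<theta>)"
      using maps by (auto simp: Aut_def compose_def fun_eq_iff)
  next
    fix \<phi> assume "\<phi> \<in> carrier (Aut A X)"
    then show "\<one>\<^bsub>Aut A X\<^esub> \<otimes>\<^bsub>Aut A X\<^esub> \<phi> = \<phi>"
      using maps by (auto simp: Aut_def compose_def fun_eq_iff extensional_def)
  next
    fix \<phi> assume f: "\<phi> \<in> carrier (Aut A X)"
    then have h: "homeomorphic_map ?T ?T \<phi>" and e: "\<And>x. x \<in> X \<Longrightarrow> \<phi> (shift x) = shift (\<phi> x)"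
      by (auto simp: Aut_def)
    from h obtain \<psi> where hm: "homeomorphic_maps ?T ?T \<phi> \<psi>"
      using homeomorphic_map_maps by blast
    then have inv: "\<And>x. x \<in> X \<Longrightarrow> \<psi> (\<phi> x) = x" "\<And>x. x \<in> X \<Longrightarrow> \<phi> (\<psi> x) = x"
      unfolding homeomorphic_maps_def top by blast+
    have g: "homeomorphic_map ?T ?T \<psi>"
      using hm homeomorphic_maps_map by blast
    then have "homeomorphic_map ?T ?T (restrict \<psi> X)"
      by (rule homeomorphic_map_eq) (simp add: top)
    moreover have "\<psi> (shift x) = shift (\<psi> x)" if "x \<in> X" for x
      using that e inv maps[OF g] maps[OF h] sX by metis
    ultimately have "restrict \<psi> X \<in> carrier (Aut A X)"
      using sX by (auto simp: Aut_def)
    moreover have "restrict \<psi> X \<otimes>\<^bsub>Aut A X\<^esub> \<phi> = \<one>\<^bsub>Aut A X\<^esub>"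
      using inv maps[OF h] by (auto simp: Aut_def compose_def fun_eq_iff)
    ultimately show "\<exists>\<psi>\<in>carrier (Aut A X). \<psi> \<otimes>\<^bsub>Aut A X\<^esub> \<phi> = \<one>\<^bsub>Aut A X\<^esub>"
      by blast
  qed
qed

lemma shift_subgroup_central:
  assumes X: "subshift A X" and "h \<in> shift_subgroup A X" and g: "g \<in> carrier (Aut A X)"
  shows "h \<in> carrier (Aut A X)" and "g \<otimes>\<^bsub>Aut A X\<^esub> h = h \<otimes>\<^bsub>Aut A X\<^esub> g"
proof -
  interpret group "Aut A X" by (rule group_Aut[OF X])
  let ?s = "restrict shift X"
  have s: "?s \<in> carrier (Aut A X)" by (rule restrict_shift_in_Aut[OF X])
  have maps: "\<phi> x \<in> X" if "\<phi> \<in> carrier (Aut A X)" "x \<in> X" for \<phi> x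
    using homeomorphic_imp_surjective_map[of "subshift_topology A X" "subshift_topology A X" \<phi>]
      that topspace_subshift_topology[OF X] by (auto simp: Aut_def)
  have comm: "g \<otimes>\<^bsub>Aut A X\<^esub> ?s = ?s \<otimes>\<^bsub>Aut A X\<^esub> g"
    using g maps by (auto simp: Aut_def compose_def fun_eq_iff)
  obtain k :: int where k: "h = ?s [^]\<^bsub>Aut A X\<^esub> k"
    using assms(2) generate_pow[OF s] by (auto simp: shift_subgroup_def)
  show "h \<in> carrier (Aut A X)"
    using s by (simp add: k)
  have "h \<in> generate (Aut A X) {?s}"
    using assms(2) by (simp add: shift_subgroup_def)
  then show "g \<otimes>\<^bsub>Aut A X\<^esub> h = h \<otimes>\<^bsub>Aut A X\<^esub> g"
  proof (induction rule: generate.induct)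
    case one
    then show ?case using g by simp
  next
    case (incl h)
    then have h: "h = ?s" by simp
    show ?case unfolding h by (rule comm)
  next
    case (inv h)
    then have h: "h = ?s" by simp
    show ?case
      unfolding h using comm g s
      by (metis inv_closed inv_solve_left inv_solve_right m_assoc m_closed)
  next
    case (eng h1 h2)
    then have "h1 \<in> carrier (Aut A X)" "h2 \<in> carrier (Aut A X)"
      using s generate_in_carrier[of "{?s}"] by auto
    then show ?case using eng.IH g by (metis m_assoc)
  qed
qed

lemma shift_subgroup_normal:
  assumes X: "subshift A X" shows "shift_subgroup A X \<lhd> Aut A X"
proof -
  interpret group "Aut A X" by (rule group_Aut[OF X])
  have "subgroup (shift_subgroup A X) (Aut A X)"
    unfolding shift_subgroup_def
    using restrict_shift_in_Aut[OF X] by (intro generate_is_subgroup) auto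
  moreover have "g \<otimes>\<^bsub>Aut A X\<^esub> h \<otimes>\<^bsub>Aut A X\<^esub> inv\<^bsub>Aut A X\<^esub> g \<in> shift_subgroup A X"
    if "g \<in> carrier (Aut A X)" "h \<in> shift_subgroup A X" for g h
    using shift_subgroup_central[OF X that(2,1)] that
    by (simp add: m_assoc)
  ultimately show ?thesis
    by (simp add: normal_inv_iff)
qed

end

theory Submission
  imports Defs "HOL-Algebra.Multiplicative_Group"
begin

text \<open>Fix an automorphism \<open>\<phi>\<close> and a point \<open>x \<in> X\<close>, and write the orbit of \<open>x\<close> under \<open>\<phi>\<close> as a colouring of the
  plane, \<open>\<eta> (i, j) = (\<phi>\<^sup>j x) i\<close>.  The theorem follows once all these space-time diagrams share one
  nonzero period \<open>(p, q)\<close>, for then \<open>\<phi>\<^sup>q = \<sigma>\<^sup>-\<^sup>p\<close> on \<open>X\<close>: if \<open>q \<noteq> 0\<close>, the class of \<open>\<phi>\<close> has finite order, and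
  if \<open>q = 0\<close>, every point of \<open>X\<close> is \<open>p\<close>-periodic, so \<open>X\<close> and its automorphism group are finite.

  \<^bold>\<open>Local periods.\<close>  By compactness, \<open>\<phi>\<close> and its inverse are sliding block codes of some radius \<open>r\<close>, so a
  horizontal word of length \<open>2 * L + 1\<close> determines \<open>\<eta>\<close> on the diamond \<open>\<bar>s\<bar> + r * \<bar>t\<bar> \<le> L\<close> around its
  centre (\<open>light_cone\<close>).  Subquadratic growth gives \<open>n\<close> and \<open>T\<close>, with \<open>n\<close> larger than a prescribed
  multiple of \<open>T\<close>, such that fewer than \<open>T\<^sup>2\<close> words of length \<open>n\<close> occur.  Hence two of the \<open>T\<^sup>2\<close> words that
  start in a \<open>T \<times> T\<close> square are equal, and their difference is a local period of \<open>\<eta>\<close>: near every point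
  of the plane, \<open>\<eta>\<close> has a nonzero period of size at most some \<open>m\<close> that is small compared to the size of the
  neighbourhood on which it is valid (\<open>block_complexity_local_period\<close>).

  \<^bold>\<open>From local periods to a global one\<close> (\<open>globally_periodic\<close>).  The period may depend on the point, and
  its direction has to be controlled.  Call a point unidirectional if all short periods near it are
  parallel.  A translation by a local period preserves this property, so from a unidirectional point
  one can walk in steps of size at most \<open>m\<close> along an entire line in the unique direction of that
  point.  If two unidirectional points had nonparallel directions, their lines would cross; near the
  crossing there would be unidirectional points of both kinds so close to each other that one local
  period serves both, a contradiction (\<open>unidirectional_parallel\<close>).  So all unidirectional points have
  the same direction \<open>u\<close>.  Near any other point there are two independent periods, thus \<open>\<eta>\<close> is locally
  invariant under a lattice with a small fundamental domain, and any further period seen on such a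
  domain is automatically valid on a large neighbourhood (\<open>period_spreads\<close>).  Therefore a period
  parallel to \<open>u\<close> can be carried from each point to its neighbours, and \<open>\<eta>\<close> has local periods parallel
  to \<open>u\<close> everywhere.  On a line parallel to \<open>u\<close> this is a question about one sequence with local
  periods bounded by \<open>m\<close>, which is globally periodic (\<open>local_periods_imp_period\<close>).  The factorial
  of \<open>m\<close> is a common multiple of the resulting periods, so that the period of \<open>\<eta>\<close> lies in a finite set
  that is independent of \<open>x\<close>.

  \<^bold>\<open>Transitivity.\<close>  The sets of points whose diagram has a given period are closed and shift-invariant,
  and finitely many of them cover \<open>X\<close>; by transitivity one of them is \<open>X\<close>
  (\<open>transitive_finite_closed_cover\<close>).\<close>

section \<open>Local periods of colourings of the plane\<close>

declare split_paired_All [simp del] split_paired_Ex [simp del]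

definition det2 :: "int \<times> int \<Rightarrow> int \<times> int \<Rightarrow> int" where
  "det2 u v = fst u * snd v - snd u * fst v"

definition zscale :: "int \<Rightarrow> int \<times> int \<Rightarrow> int \<times> int" where
  "zscale k v = (k * fst v, k * snd v)"

text \<open>The light-cone norm: its balls are the diamonds that a cellular automaton of radius \<open>r\<close> fills from
  a horizontal segment.\<close>

definition wnorm :: "int \<Rightarrow> int \<times> int \<Rightarrow> int" where
  "wnorm r v = \<bar>fst v\<bar> + r * \<bar>snd v\<bar>"

text \<open>Only \<open>h\<close>, not \<open>h + v\<close>, has to lie in the ball.  This convention makes the property monotone in \<open>R\<close>
  with no loss, at the price of losing \<open>wnorm r v\<close> when \<open>v\<close> is replaced by \<open>- v\<close>.\<close>

definition locally_periodic ::
  "int \<Rightarrow> (int \<times> int \<Rightarrow> 'a) \<Rightarrow> int \<times> int \<Rightarrow> int \<times> int \<Rightarrow> int \<Rightarrow> bool" where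
  "locally_periodic r \<eta> v g R \<longleftrightarrow> (\<forall>h. wnorm r (h - g) \<le> R \<longrightarrow> \<eta> (h + v) = \<eta> h)"

lemmas plane_defs = det2_def zscale_def prod_eq_iff

lemma wnorm_scale: "wnorm r (zscale k v) = \<bar>k\<bar> * wnorm r v"
  by (simp add: wnorm_def zscale_def abs_mult algebra_simps)

lemma wnorm_uminus: "wnorm r (- v) = wnorm r v"
  by (simp add: wnorm_def)

lemma wnorm_add:
  assumes "0 \<le> r" shows "wnorm r (v + w) \<le> wnorm r v + wnorm r w"
proof -
  have "r * \<bar>snd v + snd w\<bar> \<le> r * (\<bar>snd v\<bar> + \<bar>snd w\<bar>)"
    using assms by (intro mult_left_mono abs_triangle_ineq) auto
  then show ?thesis
    using abs_triangle_ineq[of "fst v" "fst w"] by (simp add: wnorm_def algebra_simps)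
qed

lemma wnorm_nonneg: "0 \<le> r \<Longrightarrow> 0 \<le> wnorm r v"
  by (simp add: wnorm_def)

lemma wnorm_ge_1:
  assumes "1 \<le> r" "v \<noteq> 0" shows "1 \<le> wnorm r v"
proof (cases "snd v = 0")
  case True
  then show ?thesis using assms by (auto simp: wnorm_def prod_eq_iff)
next
  case False
  then have "1 * 1 \<le> r * \<bar>snd v\<bar>"
    using assms by (intro mult_mono) auto
  then show ?thesis by (simp add: wnorm_def)
qed

lemma parallel_trans:
  assumes "det2 u v = 0" "det2 v w = 0" "v \<noteq> 0" shows "det2 u w = 0"
proof -
  have "fst v * det2 u w = fst u * det2 v w + fst w * det2 u v"
    "snd v * det2 u w = snd u * det2 v w + snd w * det2 u v"
    by (simp_all add: det2_def algebra_simps)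
  then show ?thesis using assms by (auto simp: prod_eq_iff)
qed

lemma det2_zero_commute: "det2 u v = 0 \<longleftrightarrow> det2 v u = 0"
  by (auto simp: det2_def algebra_simps)

lemma cramer: "zscale (det2 w w') x = zscale (det2 x w') w + zscale (det2 w x) w'"
  by (simp add: plane_defs algebra_simps)

lemma locally_periodicD:
  "locally_periodic r \<eta> v g R \<Longrightarrow> wnorm r (h - g) \<le> R \<Longrightarrow> \<eta> (h + v) = \<eta> h"
  unfolding locally_periodic_def by blast

lemma locally_periodic_mono:
  assumes "0 \<le> r" "locally_periodic r \<eta> v g R" "R' + wnorm r (g' - g) \<le> R"
  shows "locally_periodic r \<eta> v g' R'"
  unfolding locally_periodic_def
proof (intro allI impI)
  fix h assume h: "wnorm r (h - g') \<le> R'"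
  have "wnorm r ((h - g') + (g' - g)) \<le> wnorm r (h - g') + wnorm r (g' - g)"
    by (rule wnorm_add[OF assms(1)])
  then have "wnorm r (h - g) \<le> R" using h assms(3) by simp
  then show "\<eta> (h + v) = \<eta> h" using assms(2) by (rule locally_periodicD[rotated])
qed

lemma locally_periodic_neg:
  assumes "0 \<le> r" "locally_periodic r \<eta> v g R" "R' + wnorm r v \<le> R"
  shows "locally_periodic r \<eta> (- v) g R'"
  unfolding locally_periodic_def
proof (intro allI impI)
  fix h assume h: "wnorm r (h - g) \<le> R'"
  have "wnorm r ((h - g) + (- v)) \<le> wnorm r (h - g) + wnorm r (- v)"
    by (rule wnorm_add[OF assms(1)])
  moreover have "(h - v) - g = (h - g) + (- v)" by simp
  ultimately have "wnorm r ((h - v) - g) \<le> R" using h assms(3) by (simp only: wnorm_uminus)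
  then have "\<eta> ((h - v) + v) = \<eta> (h - v)" using assms(2) by (rule locally_periodicD[rotated])
  then show "\<eta> (h + - v) = \<eta> h" by simp
qed

lemma locally_periodic_unit_multiple:
  assumes "0 \<le> r" "locally_periodic r \<eta> v g R" "R' + wnorm r v \<le> R" "\<bar>e\<bar> \<le> 1"
  shows "locally_periodic r \<eta> (zscale e v) g R'"
proof -
  have "e = 0 \<or> e = 1 \<or> e = -1" using assms(4) by auto
  moreover have "locally_periodic r \<eta> v g R'"
    by (rule locally_periodic_mono[OF assms(1,2)])
      (use assms(3) wnorm_nonneg[OF assms(1), of v] in \<open>auto simp: wnorm_def\<close>)
  moreover have "zscale 0 v = 0" "zscale 1 v = v" "zscale (-1) v = - v"
    by (auto simp: plane_defs)
  ultimately show ?thesis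
    using locally_periodic_neg[OF assms(1-3)] by (auto simp: locally_periodic_def)
qed

text \<open>Discretised straight lines: the point \<open>k * a div n\<close> runs from \<open>0\<close> to \<open>a\<close> in \<open>n\<close> steps and never jumps
  by more than one.\<close>

lemma scaled_div_step:
  fixes a n k :: int
  assumes "\<bar>a\<bar> \<le> n" "0 < n"
  shows "\<bar>((k + 1) * a) div n - (k * a) div n\<bar> \<le> 1"
proof -
  have "(k + 1) * a = k * a + a" by (simp add: algebra_simps)
  then have "(k * a - n) div n \<le> ((k + 1) * a) div n" "((k + 1) * a) div n \<le> (k * a + n) div n"
    using assms by (simp_all only:, intro zdiv_mono1; simp)+
  moreover have "(k * a - n) div n = (k * a) div n - 1" "(k * a + n) div n = (k * a) div n + 1"
    using assms div_add_self2[of n "k * a"] div_add_self2[of n "k * a - n"] by auto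
  ultimately show ?thesis by linarith
qed

lemma scale_cancel_le:
  assumes "n \<noteq> 0" "wnorm r (zscale n v) \<le> \<bar>n\<bar> * R" shows "wnorm r v \<le> R"
  using assms by (simp add: wnorm_scale)

text \<open>Two points of a ball that differ by a lattice vector \<open>a * w + b * w'\<close> have to be joined by steps
  \<open>\<plusminus> w\<close>, \<open>\<plusminus> w'\<close>.  Using up all of \<open>a\<close> first and \<open>b\<close> afterwards can leave the ball, since \<open>w\<close> and \<open>w'\<close> may
  be almost parallel; the path below follows the straight segment at distance at most \<open>2 * m\<close>.\<close>

lemma lattice_invariance:
  assumes r: "0 \<le> r"
    and w: "locally_periodic r \<eta> w g (R + 4 * m)" "wnorm r w \<le> m"
    and w': "locally_periodic r \<eta> w' g (R + 4 * m)" "wnorm r w' \<le> m"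
    and x: "wnorm r (x - g) \<le> R" "wnorm r (x + (zscale a w + zscale b w') - g) \<le> R"
  shows "\<eta> (x + (zscale a w + zscale b w')) = \<eta> x"
proof -
  define n where "n = max 1 (max \<bar>a\<bar> \<bar>b\<bar>)"
  have n: "0 < n" "\<bar>a\<bar> \<le> n" "\<bar>b\<bar> \<le> n" by (auto simp: n_def)
  define y where "y k = x + (zscale ((k * a) div n) w + zscale ((k * b) div n) w')" for k
  have m: "0 \<le> m" using wnorm_nonneg[OF r, of w] w by linarith
  \<comment> \<open>Up to the remainders of the two divisions, \<open>y k\<close> is the convex combination of the end points
    with weights \<open>(n - k) / n\<close> and \<open>k / n\<close>.\<close>
  have near: "wnorm r (y k - g) \<le> R + 2 * m" if k: "0 \<le> k" "k \<le> n" for k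
  proof -
    have dm: "n * ((k * a) div n) = k * a - (k * a) mod n" "n * ((k * b) div n) = k * b - (k * b) mod n"
      by (simp_all add: minus_mod_eq_mult_div)
    have "zscale n (y k - g) = (zscale (n - k) (x - g) + zscale k (x + (zscale a w + zscale b w') - g))
        + (zscale (- ((k * a) mod n)) w + zscale (- ((k * b) mod n)) w')" (is "_ = (?A + ?B) + (?C + ?D)")
    proof -
      have e: "n * (p + ((k * a) div n * s + (k * b) div n * t) - q) =
        (n - k) * (p - q) + k * (p + (a * s + b * t) - q) + (- (k * a mod n) * s + - (k * b mod n) * t)"
        for p q s t :: int
      proof -
        have "n * (p + ((k * a) div n * s + (k * b) div n * t) - q) =
          n * (p - q) + (n * ((k * a) div n)) * s + (n * ((k * b) div n)) * t"
          by (simp add: algebra_simps)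
        then show ?thesis unfolding dm by (simp add: algebra_simps)
      qed
      show ?thesis
        using e[of "fst x" "fst w" "fst w'" "fst g"] e[of "snd x" "snd w" "snd w'" "snd g"]
        by (simp add: plane_defs y_def)
    qed
    then have "wnorm r (zscale n (y k - g)) \<le> (wnorm r ?A + wnorm r ?B) + (wnorm r ?C + wnorm r ?D)"
      using wnorm_add[OF r, of "?A + ?B" "?C + ?D"] add_mono[OF wnorm_add[OF r, of ?A ?B] wnorm_add[OF r, of ?C ?D]]
      by (simp only: order_trans)
    also have "\<dots> \<le> ((n - k) * R + k * R) + (n * m + n * m)"
    proof (intro add_mono)
      show "wnorm r ?A \<le> (n - k) * R" "wnorm r ?B \<le> k * R"
        using k x by (simp_all add: wnorm_scale mult_left_mono)
      show "wnorm r ?C \<le> n * m" "wnorm r ?D \<le> n * m"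
        using n w w' m pos_mod_bound[OF n(1)] by (auto simp: wnorm_scale less_imp_le intro!: mult_mono wnorm_nonneg r)
    qed
    also have "\<dots> = \<bar>n\<bar> * (R + 2 * m)" using n by (simp add: algebra_simps)
    finally show ?thesis by (rule scale_cancel_le[rotated]) (use n in auto)
  qed
  have step: "\<eta> (y (k + 1)) = \<eta> (y k)" if k: "0 \<le> k" "k + 1 \<le> n" for k
  proof -
    define e e' where "e = ((k + 1) * a) div n - (k * a) div n" and "e' = ((k + 1) * b) div n - (k * b) div n"
    have ee: "\<bar>e\<bar> \<le> 1" "\<bar>e'\<bar> \<le> 1"
      unfolding e_def e'_def using n by (auto intro!: scaled_div_step)
    have yk: "y (k + 1) = (y k + zscale e w) + zscale e' w'"
      by (simp add: y_def e_def e'_def plane_defs algebra_simps)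
    have p: "locally_periodic r \<eta> (zscale e w) g (R + 3 * m)"
        "locally_periodic r \<eta> (zscale e' w') g (R + 3 * m)"
      using w w' by (auto intro!: locally_periodic_unit_multiple[OF r _ _ ee(1)]
          locally_periodic_unit_multiple[OF r _ _ ee(2)])
    have ne: "wnorm r (zscale e w) \<le> 1 * m"
      unfolding wnorm_scale using ee w m by (intro mult_mono wnorm_nonneg r) auto
    have n1: "wnorm r (y k - g) \<le> R + 2 * m" using near k by simp
    have n2: "wnorm r (y k + zscale e w - g) \<le> R + 3 * m"
      using wnorm_add[OF r, of "y k - g" "zscale e w"] n1 ne by (simp add: algebra_simps)
    have "\<eta> (y (k + 1)) = \<eta> (y k + zscale e w)"
      unfolding yk by (rule locally_periodicD[OF p(2) n2])
    also have "\<dots> = \<eta> (y k)"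
      by (rule locally_periodicD[OF p(1)]) (use n1 m in simp)
    finally show ?thesis .
  qed
  have "\<eta> (y (int k)) = \<eta> (y 0)" if "int k \<le> n" for k
    using that
  proof (induction k)
    case (Suc k)
    then show ?case using step[of "int k"] by (simp add: add.commute)
  qed simp
  from this[of "nat n"] have "\<eta> (y n) = \<eta> (y 0)" using n by simp
  moreover have "y 0 = x" "y n = x + (zscale a w + zscale b w')"
    using n by (simp_all add: y_def plane_defs)
  ultimately show ?thesis by simp
qed

text \<open>Cramer's rule followed by rounding the two coordinates down.\<close>

lemma fundamental_domain:
  assumes r: "0 \<le> r" and D: "det2 w w' \<noteq> 0" and m: "wnorm r w \<le> m" "wnorm r w' \<le> m"
  obtains a b where "wnorm r (x + (zscale a w + zscale b w')) \<le> 2 * m"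
proof -
  define D where "D = det2 w w'"
  define a b where "a = det2 x w' div D" and "b = det2 w x div D"
  have e: "D * p - (D * a * s + D * b * t) = (det2 x w' mod D) * s + (det2 w x mod D) * t"
    if "D * p = det2 x w' * s + det2 w x * t" for p s t
  proof -
    have "D * a = det2 x w' - det2 x w' mod D" "D * b = det2 w x - det2 w x mod D"
      by (simp_all add: a_def b_def minus_mod_eq_mult_div)
    then have "D * a * s = (det2 x w' - det2 x w' mod D) * s" "D * b * t = (det2 w x - det2 w x mod D) * t"
      by simp_all
    then show ?thesis using that by (simp only: left_diff_distrib)
  qed
  have "zscale D (x + (zscale (- a) w + zscale (- b) w')) =
      zscale (det2 x w' mod D) w + zscale (det2 w x mod D) w'" (is "_ = ?A + ?B")
    using e[of "fst x" "fst w" "fst w'"] e[of "snd x" "snd w" "snd w'"] cramer[of w w' x]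
    by (simp add: zscale_def prod_eq_iff D_def[symmetric] algebra_simps)
  then have "wnorm r (zscale D (x + (zscale (- a) w + zscale (- b) w'))) \<le> wnorm r ?A + wnorm r ?B"
    using wnorm_add[OF r, of ?A ?B] by simp
  also have "\<dots> \<le> \<bar>D\<bar> * m + \<bar>D\<bar> * m"
    unfolding wnorm_scale using D m
    by (intro add_mono mult_mono wnorm_nonneg r) (auto simp: D_def abs_mod_less less_imp_le)
  also have "\<dots> = \<bar>D\<bar> * (2 * m)" by simp
  finally have "wnorm r (x + (zscale (- a) w + zscale (- b) w')) \<le> 2 * m"
    by (rule scale_cancel_le[rotated]) (use D in \<open>simp add: D_def\<close>)
  then show ?thesis by (rule that)
qed

text \<open>Two independent local periods \<open>w\<close>, \<open>w'\<close> reduce every point to a fundamental domain near the centre,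
  so a third period need only be known there.  This is what makes points with several directions
  harmless: they accept every period that a neighbour has, and return it with a radius that has not
  shrunk, so that the argument can be iterated along a path of any length.\<close>

lemma period_spreads:
  assumes r: "0 \<le> r" and D: "det2 w w' \<noteq> 0"
    and w: "locally_periodic r \<eta> w g (R + 5 * m)" "wnorm r w \<le> m"
    and w': "locally_periodic r \<eta> w' g (R + 5 * m)" "wnorm r w' \<le> m"
    and v: "locally_periodic r \<eta> v g (2 * m)" "wnorm r v \<le> m" and R: "2 * m \<le> R"
  shows "locally_periodic r \<eta> v g R"
  unfolding locally_periodic_def
proof (intro allI impI)
  fix h assume h: "wnorm r (h - g) \<le> R"
  obtain a b where ab: "wnorm r ((h - g) + (zscale a w + zscale b w')) \<le> 2 * m"
    using fundamental_domain[OF r D w(2) w'(2)] .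
  define l where "l = zscale a w + zscale b w'"
  have m: "0 \<le> m" using wnorm_nonneg[OF r, of w] w by linarith
  have "h + l - g = (h - g) + l" by simp
  then have hl: "wnorm r (h + l - g) \<le> 2 * m" using ab by (simp only: l_def)
  have hv: "wnorm r (h + v - g) \<le> R + m"
    using wnorm_add[OF r, of "h - g" v] h v by (simp add: algebra_simps)
  have hvl: "wnorm r (h + v + l - g) \<le> R + m"
    using wnorm_add[OF r, of "h + l - g" v] hl v R by (simp add: algebra_simps)
  have p: "locally_periodic r \<eta> w g (R + m + 4 * m)" "locally_periodic r \<eta> w' g (R + m + 4 * m)"
    using w w' by (simp_all add: algebra_simps)
  have inv: "\<eta> (x + l) = \<eta> x" if "wnorm r (x - g) \<le> R + m" "wnorm r (x + l - g) \<le> R + m" for x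
    unfolding l_def by (rule lattice_invariance[OF r p(1) w(2) p(2) w'(2)])
      (use that in \<open>auto simp: l_def\<close>)
  have "\<eta> (h + v) = \<eta> (h + v + l)" using inv[OF hv hvl] by simp
  also have "\<dots> = \<eta> (h + l + v)" by (simp add: algebra_simps)
  also have "\<dots> = \<eta> (h + l)" by (rule locally_periodicD[OF v(1) hl])
  also have "\<dots> = \<eta> h" by (rule inv) (use h hl R m in auto)
  finally show "\<eta> (h + v) = \<eta> h" .
qed

text \<open>The local period \<open>p\<close> at \<open>0\<close> is in fact global.  To extend it to the next position \<open>j\<close>, move back by the
  local period \<open>q\<close> that is valid around \<open>j\<close>, into the part where \<open>p\<close> is already known; both \<open>j - q\<close> and
  \<open>j + p - q\<close> are within \<open>P\<close> of \<open>j\<close>.\<close>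

lemma local_periods_imp_period:
  fixes s :: "int \<Rightarrow> 'a" and P :: int
  assumes loc: "\<And>i. \<exists>p. 1 \<le> p \<and> p \<le> P \<and> (\<forall>j. \<bar>j - i\<bar> \<le> P \<longrightarrow> s (j + p) = s j)"
  shows "\<exists>p. 1 \<le> p \<and> p \<le> P \<and> (\<forall>j. s (j + p) = s j)"
proof -
  obtain p where p: "1 \<le> p" "p \<le> P" "\<And>j. \<bar>j\<bar> \<le> P \<Longrightarrow> s (j + p) = s j"
    using loc[of 0] by auto
  have up: "s (j + p) = s j" if "- P \<le> j" "j < int k" for j k
    using that
  proof (induction k arbitrary: j)
    case (Suc k)
    show ?case
    proof (cases "j \<le> P")
      case True
      then show ?thesis using Suc.prems(1) by (intro p(3)) (simp add: abs_le_iff)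
    next
      case False
      obtain q where q: "1 \<le> q" "q \<le> P" "\<And>i. \<bar>i - j\<bar> \<le> P \<Longrightarrow> s (i + q) = s i"
        using loc[of j] by blast
      have "s (j + p) = s (j - q + p)" 
        using q(3)[of "j - q + p"] q(1,2) p(1,2) by (simp add: abs_le_iff)
      also have "\<dots> = s (j - q)" 
        by (rule Suc.IH) (use Suc.prems q(1,2) False in auto)
      also have "\<dots> = s j" using q(3)[of "j - q"] q(1,2) by simp
      finally show ?thesis .
    qed
  next
    case 0
    show ?case by (rule p(3)) (use 0 in auto)
  qed
  have down: "s (j + p) = s j" if "- int k \<le> j" for j k
    using that
  proof (induction k arbitrary: j)
    case 0
    show ?case by (rule up[of j "nat j + 1"]) (use 0 p(1,2) in auto)
  next
    case (Suc k)
    show ?case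
    proof (cases "- P \<le> j")
      case True
      then show ?thesis by (rule up[of j "nat j + 1"]) auto
    next
      case False
      obtain q where q: "1 \<le> q" "q \<le> P" "\<And>i. \<bar>i - j\<bar> \<le> P \<Longrightarrow> s (i + q) = s i"
        using loc[of j] by blast
      have "s j = s (j + q)" using q(3)[of j] q(1,2) by simp
      also have "\<dots> = s (j + q + p)" using Suc.IH[of "j + q"] Suc.prems q(1) by simp
      also have "\<dots> = s (j + p + q)" by (simp add: algebra_simps)
      also have "\<dots> = s (j + p)" using q(3)[of "j + p"] p(1,2) by simp
      finally show ?thesis by simp
    qed
  qed
  have "s (j + p) = s j" for j by (rule down[of "nat (- j)"]) auto
  then show ?thesis using p by blast
qed

lemma period_mult:
  fixes s :: "int \<Rightarrow> 'a"
  assumes "\<And>j. s (j + p) = s j" shows "s (j + int k * p) = s j"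
proof (induction k)
  case (Suc k)
  have "s (j + int (Suc k) * p) = s ((j + int k * p) + p)" by (simp add: algebra_simps)
  then show ?case using assms Suc by simp
qed simp

section \<open>From local periods to a global period\<close>

text \<open>The radius \<open>12 * m\<close> leaves room for the successive losses below: directions are read off on balls of
  radius \<open>10 * m\<close>, so that points at distance \<open>2 * m\<close> can be compared, and periods are propagated on
  balls of radius \<open>3 * m\<close>.  The condition \<open>r \<le> m\<close> says that vertical unit steps have norm at most \<open>m\<close>.\<close>

locale locally_periodic_everywhere =
  fixes r m :: int and \<eta> :: "int \<times> int \<Rightarrow> 'a"
  assumes r: "1 \<le> r" and rm: "r \<le> m"
    and local_period: "\<And>g. \<exists>v. v \<noteq> 0 \<and> wnorm r v \<le> m \<and> locally_periodic r \<eta> v g (12 * m)"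
begin

definition unidirectional :: "int \<times> int \<Rightarrow> int \<times> int \<Rightarrow> bool" where
  "unidirectional u g \<longleftrightarrow>
     (\<forall>v. v \<noteq> 0 \<longrightarrow> wnorm r v \<le> m \<longrightarrow> locally_periodic r \<eta> v g (10 * m) \<longrightarrow> det2 u v = 0)"

lemma r0: "0 \<le> r" and m0: "0 < m" using r rm by auto

lemma local_period_10:
  assumes "locally_periodic r \<eta> v g (12 * m)" "wnorm r (g' - g) \<le> 2 * m"
  shows "locally_periodic r \<eta> v g' (10 * m)"
  by (rule locally_periodic_mono[OF r0 assms(1)]) (use assms(2) in simp)

text \<open>A period \<open>v\<close> valid on the ball of radius \<open>12 * m\<close> identifies the patterns around \<open>g\<close> and \<open>g + v\<close>, hence
  also their sets of short periods.  Both signs are provided so that one can walk along the line in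
  either direction.\<close>

lemma unidirectional_translate:
  assumes u: "unidirectional u g"
  obtains v where "v \<noteq> 0" "wnorm r v \<le> m" "det2 u v = 0"
    "unidirectional u (g + v)" "unidirectional u (g - v)"
proof -
  obtain v where v: "v \<noteq> 0" "wnorm r v \<le> m" and per: "locally_periodic r \<eta> v g (12 * m)"
    using local_period by blast
  have "locally_periodic r \<eta> v g (10 * m)"
    by (rule local_period_10[OF per]) (use m0 in \<open>simp add: wnorm_def\<close>)
  then have par: "det2 u v = 0" using u v unfolding unidirectional_def by blast
  have pull_back: "locally_periodic r \<eta> x g (10 * m)"
    if x: "wnorm r x \<le> m" "locally_periodic r \<eta> x (g + t) (10 * m)"
      and t: "locally_periodic r \<eta> t g (11 * m)" for x t
    unfolding locally_periodic_def
  proof (intro allI impI)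
    fix h assume h: "wnorm r (h - g) \<le> 10 * m"
    have "wnorm r (h + x - g) \<le> 11 * m"
      using wnorm_add[OF r0, of "h - g" x] h x by (simp add: algebra_simps)
    then have "\<eta> (h + x) = \<eta> (h + x + t)"
      using locally_periodicD[OF t] by metis
    also have "\<dots> = \<eta> (h + t + x)" by (simp add: algebra_simps)
    also have "\<dots> = \<eta> (h + t)"
      by (rule locally_periodicD[OF x(2)]) (use h in simp)
    also have "\<dots> = \<eta> h"
      by (rule locally_periodicD[OF t]) (use h m0 in simp)
    finally show "\<eta> (h + x) = \<eta> h" .
  qed
  have "locally_periodic r \<eta> v g (11 * m)"
    by (rule locally_periodic_mono[OF r0 per]) (use m0 in \<open>simp add: wnorm_def\<close>)
  moreover have "locally_periodic r \<eta> (- v) g (11 * m)"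
    by (rule locally_periodic_neg[OF r0 per]) (use v in simp)
  ultimately have "unidirectional u (g + v)" "unidirectional u (g + (- v))"
    using u pull_back unfolding unidirectional_def by blast+
  then show ?thesis using that v par by simp
qed

text \<open>The number \<open>det2 (x - g) u'\<close> is, up to the factor \<open>det2 u u'\<close>, the coordinate of \<open>x - g\<close> along \<open>u\<close> in the
  basis \<open>u, u'\<close>.  As long as this part of \<open>x - g\<close> is longer than \<open>m\<close>, a step along the line through
  \<open>g\<close> shortens it.\<close>

lemma unidirectional_descent:
  assumes u: "unidirectional u g" and indep: "det2 u u' \<noteq> 0"
    and far: "m * \<bar>det2 u u'\<bar> < \<bar>det2 (x - g) u'\<bar> * wnorm r u"
  obtains t where "det2 u t = 0" "unidirectional u (g + t)"
    "\<bar>det2 (x - (g + t)) u'\<bar> < \<bar>det2 (x - g) u'\<bar>"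
proof -
  obtain v where v: "v \<noteq> 0" "wnorm r v \<le> m" "det2 u v = 0"
    "unidirectional u (g + v)" "unidirectional u (g - v)"
    using unidirectional_translate[OF u] .
  define d where "d = det2 v u'"
  have sh: "det2 (x - (g + v)) u' = det2 (x - g) u' - d" "det2 (x - (g - v)) u' = det2 (x - g) u' + d"
    by (simp_all add: d_def det2_def algebra_simps)
  have "d \<noteq> 0"
    using parallel_trans[OF v(3), of u'] v(1) indep by (auto simp: d_def)
  have "zscale (det2 u u') v = zscale d u"
    using cramer[of u u' v] v(3) by (simp add: d_def plane_defs)
  then have "wnorm r (zscale d u) = wnorm r (zscale (det2 u u') v)" by simp
  then have "\<bar>d\<bar> * wnorm r u = \<bar>det2 u u'\<bar> * wnorm r v" by (simp add: wnorm_scale)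
  also have "\<dots> \<le> \<bar>det2 u u'\<bar> * m" using v by (intro mult_left_mono) auto
  finally have "\<bar>d\<bar> * wnorm r u < \<bar>det2 (x - g) u'\<bar> * wnorm r u"
    using far by (simp add: mult.commute)
  then have d: "\<bar>d\<bar> < \<bar>det2 (x - g) u'\<bar>"
    using wnorm_nonneg[OF r0, of u] by (simp add: mult_less_cancel_right)
  show ?thesis
  proof (cases "0 < d \<longleftrightarrow> 0 < det2 (x - g) u'")
    case True
    then show ?thesis using that[of v] v d \<open>d \<noteq> 0\<close> sh by auto
  next
    case False
    have "det2 u (- v) = 0" using v(3) by (simp add: det2_def)
    then show ?thesis using that[of "- v"] v d \<open>d \<noteq> 0\<close> False sh by auto
  qed
qed

text \<open>The crossing of two lines without real numbers: among all pairs of unidirectional points with the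
  two given directions, take one that is closest in the coordinates of the basis \<open>u, u'\<close>.  By descent
  both coordinate vectors of the difference have norm at most \<open>m\<close>, so the points are at distance at
  most \<open>2 * m\<close> and share a local period, which would have to be parallel to both \<open>u\<close> and \<open>u'\<close>.\<close>

lemma unidirectional_parallel:
  assumes "unidirectional u g" "unidirectional u' g'"
  shows "det2 u u' = 0"
proof (rule ccontr)
  assume D: "det2 u u' \<noteq> 0"
  define P where "P = (\<lambda>(x, x'). unidirectional u x \<and> unidirectional u' x')"
  define f where "f = (\<lambda>(x, x'). nat (\<bar>det2 (x' - x) u'\<bar> + \<bar>det2 (x - x') u\<bar>))"
  have "P (g, g')" using assms by (simp add: P_def)
  then obtain z where z: "P z" "\<And>z'. P z' \<Longrightarrow> f z \<le> f z'"
    using ex_has_least_nat[of P "(g, g')" f] by blast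
  obtain x x' where zx: "z = (x, x')" by (cases z)
  have x: "unidirectional u x" "unidirectional u' x'" using z by (simp_all add: zx P_def)
  have least: "\<bar>det2 (x' - x) u'\<bar> + \<bar>det2 (x - x') u\<bar> \<le> \<bar>det2 (y' - y) u'\<bar> + \<bar>det2 (y - y') u\<bar>"
    if "unidirectional u y" "unidirectional u' y'" for y y'
    using z(2)[of "(y, y')"] that unfolding zx P_def f_def by (simp add: le_nat_iff)
  have D': "det2 u' u \<noteq> 0" "\<bar>det2 u' u\<bar> = \<bar>det2 u u'\<bar>"
    using D by (auto simp: det2_def algebra_simps)
  have a: "\<bar>det2 (x' - x) u'\<bar> * wnorm r u \<le> m * \<bar>det2 u u'\<bar>"
  proof (rule ccontr)
    assume "\<not> ?thesis"
    then obtain t where t: "det2 u t = 0" "unidirectional u (x + t)"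
      "\<bar>det2 (x' - (x + t)) u'\<bar> < \<bar>det2 (x' - x) u'\<bar>"
      using unidirectional_descent[OF x(1) D, of x'] by auto
    have "det2 (x + t - x') u = det2 (x - x') u"
      using t(1) by (simp add: det2_def algebra_simps)
    then show False using least[OF t(2) x(2)] t(3) by simp
  qed
  have b: "\<bar>det2 (x - x') u\<bar> * wnorm r u' \<le> m * \<bar>det2 u u'\<bar>"
  proof (rule ccontr)
    assume "\<not> ?thesis"
    then obtain t where t: "det2 u' t = 0" "unidirectional u' (x' + t)"
      "\<bar>det2 (x - (x' + t)) u\<bar> < \<bar>det2 (x - x') u\<bar>"
      using unidirectional_descent[OF x(2) D'(1), of x] D'(2) by auto
    have "det2 (x' + t - x) u' = det2 (x' - x) u'"
      using t(1) by (simp add: det2_def algebra_simps)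
    then show False using least[OF x(1) t(2)] t(3) by simp
  qed
  have c: "det2 u (x' - x) = det2 (x - x') u" by (simp add: det2_def algebra_simps)
  have "wnorm r (zscale (det2 u u') (x' - x)) \<le>
      wnorm r (zscale (det2 (x' - x) u') u) + wnorm r (zscale (det2 u (x' - x)) u')"
    unfolding cramer[of u u' "x' - x"] by (rule wnorm_add[OF r0])
  also have "\<dots> \<le> \<bar>det2 u u'\<bar> * (2 * m)"
    using a b by (simp add: wnorm_scale c algebra_simps)
  finally have near: "wnorm r (x' - x) \<le> 2 * m"
    by (rule scale_cancel_le[OF D])
  obtain v where v: "v \<noteq> 0" "wnorm r v \<le> m" and per: "locally_periodic r \<eta> v x (12 * m)"
    using local_period by blast
  have "locally_periodic r \<eta> v x (10 * m)"
    by (rule local_period_10[OF per]) (use m0 in \<open>simp add: wnorm_def\<close>)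
  then have "det2 u v = 0" "det2 u' v = 0"
    using x v local_period_10[OF per near] unfolding unidirectional_def by blast+
  then show False using parallel_trans[of u v u'] det2_zero_commute[of u' v] v D by simp
qed

definition periodic_along :: "int \<times> int \<Rightarrow> int \<times> int \<Rightarrow> bool" where
  "periodic_along u g \<longleftrightarrow> (\<exists>v. v \<noteq> 0 \<and> det2 u v = 0 \<and> wnorm r v \<le> m \<and> locally_periodic r \<eta> v g (3 * m))"

lemma unidirectional_imp_periodic_along:
  assumes "unidirectional u g" shows "periodic_along u g"
proof -
  obtain v where v: "v \<noteq> 0" "wnorm r v \<le> m" and per: "locally_periodic r \<eta> v g (12 * m)"
    using local_period by blast
  have "locally_periodic r \<eta> v g (10 * m)" "locally_periodic r \<eta> v g (3 * m)"
    by (rule locally_periodic_mono[OF r0 per], use m0 in \<open>simp add: wnorm_def\<close>)+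
  then show ?thesis using v assms unfolding periodic_along_def unidirectional_def by blast
qed

text \<open>If there is a unidirectional point, its direction is the one to propagate; otherwise any local period
  at the origin does.  A unidirectional point has a period in the common direction by definition, and
  any other point inherits one from its neighbour by \<open>period_spreads\<close>.\<close>

lemma ex_common_direction: "\<exists>u. u \<noteq> 0 \<and> (\<forall>g. periodic_along u g)"
proof -
  define multidirectional where "multidirectional g \<longleftrightarrow> (\<exists>w w'. det2 w w' \<noteq> 0 \<and> wnorm r w \<le> m \<and> wnorm r w' \<le> m
     \<and> locally_periodic r \<eta> w g (10 * m) \<and> locally_periodic r \<eta> w' g (10 * m))" for g
  have uni: "\<exists>v. v \<noteq> 0 \<and> unidirectional v g" if nd: "\<not> multidirectional g" for g
  proof -
    obtain v where v: "v \<noteq> 0" "wnorm r v \<le> m" and per: "locally_periodic r \<eta> v g (12 * m)"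
      using local_period by blast
    have "locally_periodic r \<eta> v g (10 * m)"
      by (rule locally_periodic_mono[OF r0 per], use m0 in \<open>simp add: wnorm_def\<close>)
    then have "unidirectional v g" using nd v unfolding multidirectional_def unidirectional_def by blast
    then show ?thesis using v by blast
  qed
  have "\<exists>u g0. u \<noteq> 0 \<and> periodic_along u g0 \<and> (\<forall>g. multidirectional g \<or> unidirectional u g)"
  proof (cases "\<forall>g. multidirectional g")
    case True
    obtain v where v: "v \<noteq> 0" "wnorm r v \<le> m" and per: "locally_periodic r \<eta> v 0 (12 * m)"
      using local_period by blast
    have "locally_periodic r \<eta> v 0 (3 * m)"
      by (rule locally_periodic_mono[OF r0 per], use m0 in \<open>simp add: wnorm_def\<close>)
    then have "periodic_along v 0" using v unfolding periodic_along_def by (intro exI[of _ v]) (simp add: det2_def)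
    then show ?thesis using v True by blast
  next
    case False
    then obtain g0 u where u: "u \<noteq> 0" "unidirectional u g0" using uni by blast
    have "unidirectional u g" if nd: "\<not> multidirectional g" for g
    proof -
      obtain u' where u': "u' \<noteq> 0" "unidirectional u' g" using uni[OF nd] by blast
      have "det2 u u' = 0" using unidirectional_parallel u(2) u'(2) .
      then show ?thesis using u'
        unfolding unidirectional_def using parallel_trans by blast
    qed
    then show ?thesis using u unidirectional_imp_periodic_along by blast
  qed
  then obtain u g0 where u: "u \<noteq> 0" "periodic_along u g0" "\<And>g. multidirectional g \<or> unidirectional u g" by blast
  have step: "periodic_along u g'" if g: "periodic_along u g" "wnorm r (g' - g) \<le> m" for g g'
  proof (cases "unidirectional u g'")
    case True
    then show ?thesis by (rule unidirectional_imp_periodic_along)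
  next
    case False
    then obtain w w' where w: "det2 w w' \<noteq> 0" "wnorm r w \<le> m" "wnorm r w' \<le> m"
      "locally_periodic r \<eta> w g' (10 * m)" "locally_periodic r \<eta> w' g' (10 * m)"
      using u(3)[of g'] unfolding multidirectional_def by blast
    obtain v where v: "v \<noteq> 0" "det2 u v = 0" "wnorm r v \<le> m" "locally_periodic r \<eta> v g (3 * m)"
      using g(1) unfolding periodic_along_def by blast
    have big: "locally_periodic r \<eta> x g' (3 * m + 5 * m)" if "locally_periodic r \<eta> x g' (10 * m)" for x
      by (rule locally_periodic_mono[OF r0 that]) (use m0 in \<open>simp add: wnorm_def\<close>)
    have "locally_periodic r \<eta> v g' (2 * m)"
      by (rule locally_periodic_mono[OF r0 v(4)]) (use g in simp)
    then have "locally_periodic r \<eta> v g' (3 * m)"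
      using period_spreads[OF r0 w(1) big[OF w(4)] w(2) big[OF w(5)] w(3) _ v(3)] m0 by simp
    then show ?thesis using v unfolding periodic_along_def by blast
  qed
  have horizontal: "periodic_along u (g + (j, 0))" if "periodic_along u g" for g j
  proof (induction j rule: int_induct[where k = 0])
    case base
    then show ?case using that by (simp add: zero_prod_def[symmetric])
  next
    case (step1 i)
    show ?case by (rule step[OF step1(2)]) (use m0 in \<open>simp add: wnorm_def\<close>)
  next
    case (step2 i)
    show ?case by (rule step[OF step2(2)]) (use m0 in \<open>simp add: wnorm_def\<close>)
  qed
  have vertical: "periodic_along u (g + (0, j))" if "periodic_along u g" for g j
  proof (induction j rule: int_induct[where k = 0])
    case base
    then show ?case using that by (simp add: zero_prod_def[symmetric])
  next
    case (step1 i)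
    show ?case by (rule step[OF step1(2)]) (use rm in \<open>simp add: wnorm_def\<close>)
  next
    case (step2 i)
    show ?case by (rule step[OF step2(2)]) (use rm in \<open>simp add: wnorm_def\<close>)
  qed
  have "periodic_along u g" for g
  proof -
    have "g0 + (fst (g - g0), 0) + (0, snd (g - g0)) = g" by (simp add: prod_eq_iff)
    then show ?thesis using vertical[OF horizontal[OF u(2)]] by metis
  qed
  then show ?thesis using u(1) by blast
qed

lemma parallel_to_primitive:
  assumes "coprime (fst u) (snd u)" "det2 u v = 0"
  obtains k where "v = zscale k u"
proof -
  obtain a b where ab: "a * fst u + b * snd u = 1"
    using assms(1) bezout_int[of "fst u" "snd u"] by auto
  have "(a * fst v + b * snd v) * fst u = (a * fst u + b * snd u) * fst v + b * det2 u v"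
    "(a * fst v + b * snd v) * snd u = (a * fst u + b * snd u) * snd v - a * det2 u v"
    by (simp_all add: det2_def algebra_simps)
  then have "fst v = (a * fst v + b * snd v) * fst u" "snd v = (a * fst v + b * snd v) * snd u"
    by (simp_all add: ab assms(2))
  then show ?thesis using that[of "a * fst v + b * snd v"] by (simp add: zscale_def prod_eq_iff)
qed

text \<open>The common direction is made primitive first, so that every parallel period is an integer multiple
  of it.  The sequences along lines parallel to \<open>u\<close> may have different periods, but all are at most
  \<open>m\<close> and therefore divide \<open>fact m\<close>.\<close>

theorem globally_periodic:
  "\<exists>u. u \<noteq> 0 \<and> wnorm r u \<le> m \<and> (\<forall>g. \<eta> (g + zscale (fact (nat m)) u) = \<eta> g)"
proof -
  obtain u' where u': "u' \<noteq> 0" "\<And>g. periodic_along u' g" using ex_common_direction by blast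
  define c where "c = gcd (fst u') (snd u')"
  define u where "u = (fst u' div c, snd u' div c)"
  have c: "c \<noteq> 0" using u'(1) by (auto simp: c_def prod_eq_iff)
  have "c dvd fst u'" "c dvd snd u'" by (simp_all add: c_def)
  then have u'u: "u' = zscale c u" by (simp add: zscale_def u_def prod_eq_iff)
  have prim: "coprime (fst u) (snd u)"
    unfolding u_def c_def fst_conv snd_conv
    by (rule div_gcd_coprime) (use u'(1) in \<open>auto simp: prod_eq_iff\<close>)
  have u0: "u \<noteq> 0" using u'(1) u'u by (auto simp: zscale_def zero_prod_def)
  have n1: "1 \<le> wnorm r u" using wnorm_ge_1[OF r u0] .
  define P where "P = m div wnorm r u"
  have P: "wnorm r (zscale k u) \<le> m \<longleftrightarrow> \<bar>k\<bar> \<le> P" for k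
  proof -
    have "\<bar>k\<bar> * wnorm r u \<le> m" if "\<bar>k\<bar> \<le> P"
    proof -
      have "\<bar>k\<bar> * wnorm r u \<le> P * wnorm r u" using that n1 by (intro mult_right_mono) auto
      also have "\<dots> \<le> m" using n1 minus_mod_eq_div_mult[of m "wnorm r u"]
          pos_mod_sign[of "wnorm r u" m] unfolding P_def by linarith
      finally show ?thesis .
    qed
    moreover have "\<bar>k\<bar> \<le> P" if "\<bar>k\<bar> * wnorm r u \<le> m"
      using zdiv_mono1[OF that, of "wnorm r u"] n1 by (simp add: P_def)
    ultimately show ?thesis by (auto simp: wnorm_scale)
  qed
  have loc: "\<exists>p. 1 \<le> p \<and> p \<le> P \<and> (\<forall>j. \<bar>j - i\<bar> \<le> P \<longrightarrow> \<eta> (g + zscale (j + p) u) = \<eta> (g + zscale j u))"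
    for g i
  proof -
    obtain v where v: "v \<noteq> 0" "det2 u' v = 0" "wnorm r v \<le> m"
      "locally_periodic r \<eta> v (g + zscale i u) (3 * m)"
      using u'(2)[of "g + zscale i u"] unfolding periodic_along_def by blast
    have "c * det2 u v = 0" using v(2) unfolding u'u by (simp add: det2_def zscale_def algebra_simps)
    then obtain k where k: "v = zscale k u" using c parallel_to_primitive[OF prim, of v] by auto
    have neg: "locally_periodic r \<eta> (- v) (g + zscale i u) m"
      by (rule locally_periodic_neg[OF r0 v(4)]) (use v(3) m0 in simp)
    have pos: "locally_periodic r \<eta> v (g + zscale i u) m"
      by (rule locally_periodic_mono[OF r0 v(4)]) (use m0 in \<open>simp add: wnorm_def\<close>)
    have k0: "k \<noteq> 0" using v(1) k by (auto simp: zscale_def zero_prod_def)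
    have kP: "\<bar>k\<bar> \<le> P" using v(3) unfolding k P .
    have absk: "locally_periodic r \<eta> (zscale \<bar>k\<bar> u) (g + zscale i u) m"
    proof (cases "0 \<le> k")
      case False
      then have "zscale \<bar>k\<bar> u = - v" by (simp add: k zscale_def prod_eq_iff)
      then show ?thesis using neg by simp
    qed (use pos k in simp)
    have "\<eta> (g + zscale (j + \<bar>k\<bar>) u) = \<eta> (g + zscale j u)" if "\<bar>j - i\<bar> \<le> P" for j
    proof -
      have "g + zscale j u - (g + zscale i u) = zscale (j - i) u"
        by (simp add: plane_defs algebra_simps)
      then have "wnorm r (g + zscale j u - (g + zscale i u)) \<le> m" using that P by simp
      then have "\<eta> (g + zscale j u + zscale \<bar>k\<bar> u) = \<eta> (g + zscale j u)"
        by (rule locally_periodicD[OF absk])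
      moreover have "g + zscale j u + zscale \<bar>k\<bar> u = g + zscale (j + \<bar>k\<bar>) u"
        by (simp add: plane_defs algebra_simps)
      ultimately show ?thesis by simp
    qed
    then show ?thesis using k0 kP by (intro exI[of _ "\<bar>k\<bar>"] conjI) simp_all
  qed
  have P_le: "P \<le> m"
  proof -
    have "m div wnorm r u \<le> m div 1" using n1 m0 by (intro zdiv_mono2) auto
    then show ?thesis by (simp add: P_def)
  qed
  have "\<eta> (g + zscale (fact (nat m)) u) = \<eta> g" for g
  proof -
    obtain p where p: "1 \<le> p" "p \<le> P" "\<And>j. \<eta> (g + zscale (j + p) u) = \<eta> (g + zscale j u)"
      using local_periods_imp_period[of P "\<lambda>j. \<eta> (g + zscale j u)"] loc[of _ g] by meson
    have "nat p dvd fact (nat m)" using p P_le by (intro dvd_fact) auto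
    then obtain q where q: "fact (nat m) = nat p * q" by auto
    have "(fact (nat m) :: int) = int (fact (nat m))" by simp
    also have "\<dots> = int q * p" using p by (simp add: q)
    finally have "fact (nat m) = int q * p" .
    moreover have "\<eta> (g + zscale (0 + int q * p) u) = \<eta> (g + zscale 0 u)"
      by (rule period_mult[of "\<lambda>j. \<eta> (g + zscale j u)"]) (rule p(3))
    ultimately show ?thesis by (simp add: zscale_def zero_prod_def[symmetric])
  qed
  moreover have "1 \<le> P" using loc[of 0 0] by auto
  then have "wnorm r (zscale 1 u) \<le> m" unfolding P by simp
  then have "wnorm r u \<le> m" by (simp add: wnorm_scale)
  ultimately show ?thesis using u0 by blast
qed

end


section \<open>Sliding block codes and transitivity\<close>

lemma shift_pow_subshift:
  fixes X :: "(int \<Rightarrow> 'a) set"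
  assumes "subshift A X" "x \<in> X" shows "shift_pow k x \<in> X"
proof -
  have sX: "shift ` X = X" using assms by (simp add: subshift_def)
  have pow_add: "shift_pow (i + j) x = shift_pow j (shift_pow i x)" for i j and x :: "int \<Rightarrow> 'a"
    by (simp add: shift_pow_apply algebra_simps)
  have up: "shift_pow 1 y \<in> X" if "y \<in> X" for y
    using sX that by (auto simp: shift_pow_apply shift_def[abs_def])
  have down: "shift_pow (-1) y \<in> X" if y: "y \<in> X" for y
  proof -
    obtain z where "z \<in> X" "y = shift z" using sX y by blast
    then show ?thesis by (simp add: shift_pow_apply shift_def)
  qed
  show ?thesis
  proof (induction k rule: int_induct[where k = 0])
    case base
    then show ?case using assms by (simp add: shift_pow_apply)
  next
    case (step1 i)
    then show ?case using up by (simp add: pow_add)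
  next
    case (step2 i)
    then show ?case using down pow_add[of i "-1"] by simp
  qed
qed

lemma compact_space_subshift:
  assumes "finite A" "subshift A X" shows "compact_space (subshift_topology A X)"
proof -
  have "compact_space (full_shift A)"
    using assms(1) by (simp add: full_shift_def compact_space_product_topology compact_space_discrete_topology)
  then show ?thesis
    using assms(2) by (simp add: compact_space_subtopology closedin_compact_space subshift_def)
qed

lemma coordinate_continuous: "continuous_map (full_shift A) (discrete_topology A) (\<lambda>x. x k)"
  unfolding full_shift_def by (rule continuous_map_product_projection) simp

lemma openin_full_shift_window:
  assumes "openin (full_shift A) W" "x \<in> W"
  obtains r :: int where "\<And>y. y \<in> topspace (full_shift A) \<Longrightarrow> (\<And>j. \<bar>j\<bar> \<le> r \<Longrightarrow> y j = x j) \<Longrightarrow> y \<in> W"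
proof -
  obtain U where U: "finite {i. U i \<noteq> A}" "x \<in> Pi\<^sub>E UNIV U" "Pi\<^sub>E UNIV U \<subseteq> W"
    using assms unfolding full_shift_def openin_product_topology_alt by auto
  define r where "r = Max (insert 0 (abs ` {i. U i \<noteq> A}))"
  have r: "\<bar>i\<bar> \<le> r" if "U i \<noteq> A" for i
    unfolding r_def using U(1) that by (intro Max_ge) auto
  have "y \<in> W" if y: "y \<in> topspace (full_shift A)" "\<And>j. \<bar>j\<bar> \<le> r \<Longrightarrow> y j = x j" for y
  proof -
    have "y j \<in> U j" for j
    proof (cases "U j = A")
      case True
      then show ?thesis using y(1) by (auto simp: topspace_full_shift)
    next
      case False
      then show ?thesis using r y(2) U(2) by (auto simp: PiE_iff)
    qed
    then show ?thesis using U(3) by auto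
  qed
  then show ?thesis by (rule that)
qed

definition has_radius :: "(int \<Rightarrow> 'a) set \<Rightarrow> ((int \<Rightarrow> 'a) \<Rightarrow> (int \<Rightarrow> 'a)) \<Rightarrow> int \<Rightarrow> bool" where
  "has_radius X f r \<longleftrightarrow>
     (\<forall>x\<in>X. \<forall>y\<in>X. \<forall>i. (\<forall>j. \<bar>j - i\<bar> \<le> r \<longrightarrow> x j = y j) \<longrightarrow> f x i = f y i)"

lemma has_radius_mono: "has_radius X f r \<Longrightarrow> r \<le> r' \<Longrightarrow> has_radius X f r'"
  unfolding has_radius_def by (meson order_trans)

lemma has_radiusD:
  assumes "has_radius X f r" "x \<in> X" "y \<in> X" "\<And>j. \<bar>j - i\<bar> \<le> r \<Longrightarrow> x j = y j"
  shows "f x i = f y i"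
  using assms unfolding has_radius_def by blast

text \<open>The Curtis--Hedlund--Lyndon theorem.  Around every point there is a cylinder on which the symbol of
  the image at \<open>0\<close> is constant; finitely many of these cover \<open>X\<close>, and the longest of their windows is a
  radius at \<open>0\<close>, hence at every position by commutation with the shift.\<close>

lemma sliding_block_code:
  assumes A: "finite A" "subshift A X"
    and cont: "continuous_map (subshift_topology A X) (subshift_topology A X) \<phi>"
    and comm: "\<And>x k. x \<in> X \<Longrightarrow> \<phi> (shift_pow k x) = shift_pow k (\<phi> x)"
  shows "\<exists>r\<ge>0. has_radius X \<phi> r"
proof -
  let ?T = "subshift_topology A X"
  note top = topspace_subshift_topology[OF A(2)]
  have XA: "X \<subseteq> topspace (full_shift A)"
    using A(2) closedin_subset by (auto simp: subshift_def)
  have cont0: "continuous_map ?T (discrete_topology A) (\<lambda>x. \<phi> x 0)"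
    using continuous_map_compose[OF cont continuous_map_from_subtopology[OF coordinate_continuous[of A 0]]]
    by (simp add: o_def)
  define V where "V c = {x \<in> X. \<phi> x 0 = c}" for c
  have "openin ?T (V c)" if "c \<in> A" for c
    
    using openin_continuous_map_preimage[OF cont0, of "{c}"] that
    unfolding top V_def by simp
  then have "\<exists>W. openin (full_shift A) W \<and> V c = W \<inter> X" if "c \<in> A" for c
    using that unfolding openin_subtopology by blast
  then obtain W where W: "\<And>c. c \<in> A \<Longrightarrow> openin (full_shift A) (W c)" "\<And>c. c \<in> A \<Longrightarrow> V c = W c \<inter> X"
    by metis
  have phiA: "\<phi> x 0 \<in> A" if "x \<in> X" for x
    using continuous_map_image_subset_topspace[OF cont0] that top by auto
  have "\<exists>r. \<forall>y\<in>X. (\<forall>j. \<bar>j\<bar> \<le> r \<longrightarrow> y j = x j) \<longrightarrow> \<phi> y 0 = \<phi> x 0" if x: "x \<in> X" for x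
  proof -
    have "x \<in> W (\<phi> x 0)" using W(2)[OF phiA[OF x]] x by (auto simp: V_def)
    then obtain r where "\<And>y. y \<in> topspace (full_shift A) \<Longrightarrow> (\<And>j. \<bar>j\<bar> \<le> r \<Longrightarrow> y j = x j) \<Longrightarrow> y \<in> W (\<phi> x 0)"
      using openin_full_shift_window[OF W(1)[OF phiA[OF x]]] by blast
    moreover have "\<phi> y 0 = \<phi> x 0" if "y \<in> X" "y \<in> W (\<phi> x 0)" for y
      using W(2)[OF phiA[OF x]] that by (auto simp: V_def)
    ultimately show ?thesis using XA by (intro exI[of _ r]) blast
  qed
  then obtain R where R: "\<And>x y. x \<in> X \<Longrightarrow> y \<in> X \<Longrightarrow> (\<And>j. \<bar>j\<bar> \<le> R x \<Longrightarrow> y j = x j) \<Longrightarrow> \<phi> y 0 = \<phi> x 0"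
    by metis
  define C where "C x = {y \<in> X. \<forall>j. \<bar>j\<bar> \<le> R x \<longrightarrow> y j = x j}" for x
  have C: "openin ?T (C x)" if x: "x \<in> X" for x
  proof -
    have "openin ?T {y \<in> topspace ?T. y j \<in> {x j}}" for j
      by (rule openin_continuous_map_preimage[OF continuous_map_from_subtopology[OF coordinate_continuous]])
        (use x XA in \<open>auto simp: topspace_full_shift\<close>)
    then have "openin ?T ({y \<in> X. y j = x j})" for j unfolding top by simp
    then have "openin ?T (X \<inter> (\<Inter>j\<in>{- R x..R x}. {y \<in> X. y j = x j}))"
    proof (cases "{- R x..R x} = {}")
      case True
      then show ?thesis using openin_topspace[of ?T] by (simp only: top) simp
    next
      case False
      show ?thesis
        by (intro openin_Int openin_Inter) (use False \<open>\<And>j. openin ?T {y \<in> X. y j = x j}\<close> openin_topspace[of ?T] top in auto)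
    qed
    moreover have "C x = X \<inter> (\<Inter>j\<in>{- R x..R x}. {y \<in> X. y j = x j})"
      by (auto simp: C_def abs_le_iff)
    ultimately show ?thesis by simp
  qed
  have "X \<subseteq> \<Union> (C ` X)" by (auto simp: C_def)
  then obtain F where F: "finite F" "F \<subseteq> X" "X \<subseteq> \<Union> (C ` F)"
    using compactinD[of ?T X "C ` X"] compact_space_subshift[OF A] C top
    unfolding compact_space_def by (metis (no_types, lifting) finite_subset_image imageE)
  define r where "r = Max (insert 0 (R ` F))"
  have r: "0 \<le> r" "\<And>x. x \<in> F \<Longrightarrow> R x \<le> r"
    unfolding r_def using F(1) by (auto intro: Max_ge)
  have at0: "\<phi> x 0 = \<phi> y 0" if xy: "x \<in> X" "y \<in> X" "\<And>j. \<bar>j\<bar> \<le> r \<Longrightarrow> x j = y j" for x y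
  proof -
    obtain z where z: "z \<in> F" "x \<in> C z" using F xy(1) by blast
    then have "\<phi> x 0 = \<phi> z 0" using R[of z x] F(2) by (auto simp: C_def)
    moreover have "\<phi> y 0 = \<phi> z 0"
    proof (rule R)
      show "y j = z j" if "\<bar>j\<bar> \<le> R z" for j
        using z that r(2)[OF z(1)] xy(3)[of j] by (auto simp: C_def)
    qed (use z F xy in auto)
    ultimately show ?thesis by simp
  qed
  have "\<phi> x i = \<phi> y i" if xy: "x \<in> X" "y \<in> X" "\<And>j. \<bar>j - i\<bar> \<le> r \<Longrightarrow> x j = y j" for x y i
  proof -
    have "\<phi> (shift_pow i x) 0 = \<phi> (shift_pow i y) 0"
      by (rule at0) (use xy shift_pow_subshift[OF A(2)] in \<open>auto simp: shift_pow_apply\<close>)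
    then show ?thesis using comm xy by (simp add: shift_pow_apply)
  qed
  then show ?thesis using r(1) unfolding has_radius_def by blast
qed

text \<open>In a transitive system, any two nonempty open invariant sets meet, and therefore so do any finitely
  many; apply this to the complements of the members of the cover.\<close>

lemma transitive_finite_closed_cover:
  assumes X: "subshift A X" and trans: "transitive_shift A X" and ne: "X \<noteq> {}" and fin: "finite \<C>"
    and closed: "\<And>C. C \<in> \<C> \<Longrightarrow> closedin (subshift_topology A X) C"
    and inv: "\<And>C x n. C \<in> \<C> \<Longrightarrow> x \<in> C \<Longrightarrow> shift_pow n x \<in> C"
    and cover: "X \<subseteq> \<Union>\<C>"
  shows "X \<in> \<C>"
proof (rule ccontr)
  assume notin: "X \<notin> \<C>"
  let ?T = "subshift_topology A X"
  note top = topspace_subshift_topology[OF X]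
  have "X - \<Union>\<D> \<noteq> {}" if "\<D> \<subseteq> \<C>" for \<D>
    using finite_subset[OF that fin] that
  proof (induction \<D> rule: finite_induct)
    case empty
    then show ?case using ne by simp
  next
    case (insert C \<D>)
    have "closedin ?T (\<Union>\<D>)" using insert closed by (intro closedin_Union) auto
    then have 1: "openin ?T (X - \<Union>\<D>)" by (metis openin_closedin_eq top openin_diff openin_topspace)
    have cC: "closedin ?T C" using insert closed by auto
    then have 2: "openin ?T (X - C)" by (metis top openin_diff openin_topspace)
    have "C \<subseteq> X" using closedin_subset[OF cC] top by simp
    moreover have "C \<noteq> X" using insert notin by auto
    ultimately have "X - C \<noteq> {}" by auto
    moreover have "X - \<Union>\<D> \<noteq> {}" using insert.IH insert.prems by simp
    ultimately obtain n :: int where "shift_pow n ` (X - \<Union>\<D>) \<inter> (X - C) \<noteq> {}"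
      using trans 1 2 unfolding transitive_shift_def by meson
    then obtain x where x: "x \<in> X - \<Union>\<D>" "shift_pow n x \<in> X - C" by blast
    have "shift_pow n x \<notin> \<Union>\<D>"
    proof
      assume "shift_pow n x \<in> \<Union>\<D>"
      then have "shift_pow (- n) (shift_pow n x) \<in> \<Union>\<D>" using inv insert.prems by blast
      then show False using x by (simp add: shift_pow_apply)
    qed
    then show ?case using x by auto
  qed
  then show False using cover by blast
qed

section \<open>Space-time diagrams of an automorphism\<close>

locale subshift_automorphism =
  fixes A :: "'a set" and X :: "(int \<Rightarrow> 'a) set" and \<phi> :: "(int \<Rightarrow> 'a) \<Rightarrow> (int \<Rightarrow> 'a)"
  assumes A: "finite A" and X: "subshift A X" and \<phi>: "\<phi> \<in> carrier (Aut A X)"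
begin

definition iterate :: "int \<Rightarrow> (int \<Rightarrow> 'a) \<Rightarrow> (int \<Rightarrow> 'a)" where
  "iterate j = \<phi> [^]\<^bsub>Aut A X\<^esub> j"

definition spacetime :: "(int \<Rightarrow> 'a) \<Rightarrow> int \<times> int \<Rightarrow> 'a" where
  "spacetime x g = iterate (snd g) x (fst g)"

lemma iterate_Aut: "iterate j \<in> carrier (Aut A X)"
  using group.int_pow_closed[OF group_Aut[OF X] \<phi>] by (simp add: iterate_def)

lemma iterate_continuous:
  "continuous_map (subshift_topology A X) (subshift_topology A X) (iterate j)"
  using iterate_Aut[of j] by (auto simp: Aut_def homeomorphic_eq_everything_map)

lemma iterate_closed: "x \<in> X \<Longrightarrow> iterate j x \<in> X"
  using continuous_map_image_subset_topspace[OF iterate_continuous[of j]]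
    topspace_subshift_topology[OF X] by auto

lemma iterate_0: "x \<in> X \<Longrightarrow> iterate 0 x = x"
  by (simp add: iterate_def Aut_def)

lemma iterate_add: "x \<in> X \<Longrightarrow> iterate (j + k) x = iterate j (iterate k x)"
  using group.int_pow_mult[OF group_Aut[OF X] \<phi>, of j k]
  by (simp add: iterate_def Aut_def compose_def)

lemma iterate_shift: "x \<in> X \<Longrightarrow> iterate j (shift x) = shift (iterate j x)"
  using iterate_Aut[of j] by (auto simp: Aut_def)

lemma iterate_shift_pow:
  assumes "x \<in> X" shows "iterate j (shift_pow k x) = shift_pow k (iterate j x)"
proof (induction k rule: int_induct[where k = 0])
  case base
  then show ?case by (simp add: shift_pow_apply)
next
  case (step1 i)
  have "shift_pow (i + 1) y = shift (shift_pow i y)" for y :: "int \<Rightarrow> 'a"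
    by (simp add: shift_pow_apply shift_def algebra_simps)
  then show ?case using iterate_shift[OF shift_pow_subshift[OF X assms]] step1 by simp
next
  case (step2 i)
  have e: "shift (shift_pow (i - 1) y) = shift_pow i y" for y :: "int \<Rightarrow> 'a"
    by (simp add: shift_pow_apply shift_def algebra_simps)
  have "shift (iterate j (shift_pow (i - 1) x)) = shift (shift_pow (i - 1) (iterate j x))"
    using iterate_shift[OF shift_pow_subshift[OF X assms, of "i - 1"], of j] step2 by (simp add: e)
  then show ?case using bij_shift by (auto simp: bij_def inj_def)
qed

lemma spacetime_translate:
  assumes "x \<in> X"
  shows "spacetime x (g + h) = spacetime (shift_pow (fst g) (iterate (snd g) x)) h"
proof -
  have "iterate (snd h) (shift_pow (fst g) (iterate (snd g) x))
      = shift_pow (fst g) (iterate (snd h + snd g) x)"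
    using assms by (simp add: iterate_shift_pow iterate_closed iterate_add)
  then show ?thesis by (simp add: spacetime_def shift_pow_apply algebra_simps)
qed

lemma ex_radius: "\<exists>r\<ge>1. has_radius X (iterate 1) r \<and> has_radius X (iterate (-1)) r"
proof -
  obtain r r' where "0 \<le> r" "has_radius X (iterate 1) r" "0 \<le> r'" "has_radius X (iterate (-1)) r'"
    using sliding_block_code[OF A X iterate_continuous iterate_shift_pow] by metis
  then show ?thesis
    by (intro exI[of _ "r + r' + 1"]) (auto elim: has_radius_mono)
qed

end

locale subshift_automorphism_radius = subshift_automorphism +
  fixes r :: int
  assumes r: "1 \<le> r"
    and radius: "has_radius X (iterate 1) r" "has_radius X (iterate (-1)) r"
begin

text \<open>Each application of the automorphism or of its inverse shortens the known segment by \<open>r\<close> at both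
  ends.\<close>

lemma light_cone:
  assumes "x \<in> X" "y \<in> X" and agree: "\<And>j. \<bar>j\<bar> \<le> L \<Longrightarrow> x j = y j" and "\<bar>i\<bar> + r * \<bar>t\<bar> \<le> L"
  shows "iterate t x i = iterate t y i"
proof -
  have step: "iterate (t + e) x i = iterate (t + e) y i"
    if e: "\<bar>e\<bar> = 1" "\<bar>t + e\<bar> = \<bar>t\<bar> + 1" and i: "\<bar>i\<bar> + r * \<bar>t + e\<bar> \<le> L"
      and IH: "\<And>i. \<bar>i\<bar> + r * \<bar>t\<bar> \<le> L \<Longrightarrow> iterate t x i = iterate t y i" for t e i
  proof -
    have "iterate e (iterate t x) i = iterate e (iterate t y) i"
    proof (rule has_radiusD[where f = "iterate e"])
      have "e = 1 \<or> e = -1" using e(1) by linarith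
      then show "has_radius X (iterate e) r" using radius by auto
      show "iterate t x \<in> X" "iterate t y \<in> X" using assms iterate_closed by auto
      fix j assume "\<bar>j - i\<bar> \<le> r"
      moreover have "r * \<bar>t + e\<bar> = r * \<bar>t\<bar> + r" using e by (simp add: algebra_simps)
      ultimately show "iterate t x j = iterate t y j" using i by (intro IH) linarith
    qed
    then show ?thesis using assms by (simp add: iterate_add[symmetric] add.commute)
  qed
  show ?thesis using assms(4)
  proof (induction t arbitrary: i rule: int_induct[where k = 0])
    case base
    then show ?case using assms by (simp add: iterate_0)
  next
    case (step1 t)
    show ?case by (rule step) (use step1 in auto)
  next
    case (step2 t)
    show ?case using step[of "-1" t i] step2 by simp
  qed
qed

text \<open>Pigeonhole: the \<open>T\<^sup>2\<close> words centred at the points of the square \<open>g + {0..<T} \<times> {0..<T}\<close> cannot all be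
  different.  Two equal words force equal diamonds around their centres, and moving the centre from
  the square back to \<open>g\<close> costs at most \<open>(1 + r) * T\<close>.\<close>

lemma block_complexity_local_period:
  assumes x: "x \<in> X" and few: "block_complexity A X n < (nat T)\<^sup>2" and n: "2 * L + 1 \<le> int n"
    and T: "1 \<le> T" and L: "0 \<le> L"
  shows "\<exists>v. v \<noteq> 0 \<and> wnorm r v \<le> (1 + r) * T \<and>
    locally_periodic r (spacetime x) v g (L - (1 + r) * T)"
proof -
  define m where "m = (1 + r) * T"
  define z where "z p = shift_pow (fst (g + p)) (iterate (snd (g + p)) x)" for p
  have z: "z p \<in> X" for p
    by (simp add: z_def shift_pow_subshift[OF X] iterate_closed x)
  have XA: "x i \<in> A" if "x \<in> X" for x i
    using X closedin_subset that by (fastforce simp: subshift_def topspace_full_shift)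
  define F where "F p = (\<lambda>i\<in>{0..<n}. z p (int i - L))" for p
  define S where "S = {0..<T} \<times> {0..<T}"
  define B where "B = {\<beta> \<in> {0..<n} \<rightarrow>\<^sub>E A. \<exists>x\<in>X. \<forall>i<n. x (int i) = \<beta> i}"
  have finB: "finite B"
    by (rule finite_subset[of _ "{0..<n} \<rightarrow>\<^sub>E A"]) (use A in \<open>auto simp: B_def intro!: finite_PiE\<close>)
  have "F ` S \<subseteq> B"
  proof
    fix f assume "f \<in> F ` S"
    then obtain p where p: "f = F p" by blast
    have "shift_pow (- L) (z p) \<in> X" using z shift_pow_subshift[OF X] by blast
    moreover have "\<forall>i<n. shift_pow (- L) (z p) (int i) = f i"
      by (simp add: p F_def shift_pow_apply)
    moreover have "f \<in> {0..<n} \<rightarrow>\<^sub>E A" using XA[OF z] by (auto simp: p F_def)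
    ultimately show "f \<in> B" unfolding B_def by blast
  qed
  then have "card (F ` S) \<le> card B" using finB by (rule card_mono[rotated])
  also have "\<dots> < card S" using few by (simp add: block_complexity_def B_def S_def power2_eq_square)
  finally have "\<not> inj_on F S" using card_image by fastforce
  then obtain p p' where p: "p \<in> S" "p' \<in> S" "p \<noteq> p'" "F p = F p'" by (auto simp: inj_on_def)
  have same: "spacetime x (g + p + h) = spacetime x (g + p' + h)" if h: "wnorm r h \<le> L" for h
  proof -
    have "z p j = z p' j" if j: "\<bar>j\<bar> \<le> L" for j
    proof -
      have "nat (j + L) < n" "int (nat (j + L)) - L = j" using j n by auto
      then show ?thesis using fun_cong[OF p(4), of "nat (j + L)"] by (simp add: F_def)
    qed
    then have "iterate (snd h) (z p) (fst h) = iterate (snd h) (z p') (fst h)"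
      by (rule light_cone[OF z z]) (use h in \<open>auto simp: wnorm_def\<close>)
    then show ?thesis unfolding spacetime_translate[OF x] z_def[symmetric] by (simp add: spacetime_def)
  qed
  have small: "wnorm r q \<le> m" if q: "\<bar>fst q\<bar> \<le> T" "\<bar>snd q\<bar> \<le> T" for q
  proof -
    have "r * \<bar>snd q\<bar> \<le> r * T" using q r by (intro mult_left_mono) auto
    then show ?thesis using q by (simp add: wnorm_def m_def algebra_simps)
  qed
  have "locally_periodic r (spacetime x) (p' - p) (g + p) L"
    unfolding locally_periodic_def
  proof (intro allI impI)
    fix h assume "wnorm r (h - (g + p)) \<le> L"
    from same[OF this] show "spacetime x (h + (p' - p)) = spacetime x h"
      by (simp add: algebra_simps)
  qed
  then have "locally_periodic r (spacetime x) (p' - p) g (L - m)"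
    by (rule locally_periodic_mono[rotated])
      (use r small[of "- p"] p in \<open>auto simp: S_def\<close>)
  moreover have "wnorm r (p' - p) \<le> m" by (rule small) (use p in \<open>auto simp: S_def\<close>)
  ultimately show ?thesis using p unfolding m_def by (intro exI[of _ "p' - p"]) auto
qed

text \<open>With \<open>m = (1 + r) * T\<close>, words of length \<open>2 * (13 * m) + 1\<close> give local periods on balls of radius
  \<open>13 * m - m = 12 * m\<close>, as needed for a global period.\<close>

lemma pointwise_relation:
  assumes x: "x \<in> X" and few: "block_complexity A X n < (nat T)\<^sup>2" and n: "26 * (1 + r) * T + 1 \<le> int n"
    and T: "1 \<le> T"
  shows "\<exists>u. u \<noteq> 0 \<and> wnorm r u \<le> (1 + r) * T \<and>
    shift_pow (fact (nat ((1 + r) * T)) * fst u) (iterate (fact (nat ((1 + r) * T)) * snd u) x) = x"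
proof -
  define m where "m = (1 + r) * T"
  have rm: "r \<le> m" "0 \<le> m"
  proof -
    have "(1 + r) * 1 \<le> (1 + r) * T" using T r by (intro mult_left_mono) auto
    then have "1 + r \<le> m" by (simp only: m_def mult_1_right)
    then show "r \<le> m" "0 \<le> m" using r by auto
  qed
  interpret locally_periodic_everywhere r m "spacetime x"
  proof
    fix g
    show "\<exists>v. v \<noteq> 0 \<and> wnorm r v \<le> m \<and> locally_periodic r (spacetime x) v g (12 * m)"
    proof -
      have "26 * m + 1 \<le> int n" using n by (simp only: m_def mult.assoc)
      then show ?thesis
        using block_complexity_local_period[OF x few, of "13 * m" g] T rm
        by (simp add: m_def[symmetric])
    qed
  qed (use r rm in auto)
  obtain u where u: "u \<noteq> 0" "wnorm r u \<le> m"
    "\<And>g. spacetime x (g + zscale (fact (nat m)) u) = spacetime x g"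
    using globally_periodic by blast
  define w where "w = zscale (fact (nat m)) u"
  have "shift_pow (fst w) (iterate (snd w) x) i = x i" for i
    using u(3)[of "(i, 0)"] x by (simp add: w_def[symmetric] spacetime_def shift_pow_apply iterate_0)
  then show ?thesis using u by (intro exI[of _ u]) (auto simp: m_def w_def zscale_def)
qed

end

text \<open>A small ratio \<open>block_complexity A X n / n\<^sup>2\<close> at a single large \<open>n\<close> suffices: take for \<open>T\<close> the integer part
  of \<open>(n - 1) / c\<close>, which is at least \<open>n / (2 * c)\<close>.\<close>

lemma subquadratic_few_words:
  assumes sub: "subquadratic_growth A X" and c: "1 \<le> (c::nat)"
  obtains n T where "1 \<le> T" "c * T + 1 \<le> n" "block_complexity A X n < T\<^sup>2"
proof -
  define \<epsilon> where "\<epsilon> = 1 / (2 * real c)\<^sup>2"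
  have \<epsilon>: "0 < \<epsilon>" using c by (simp add: \<epsilon>_def)
  have "\<exists>n\<ge>4 * c. real (block_complexity A X n) / (real n)\<^sup>2 < \<epsilon>"
  proof (rule ccontr)
    assume "\<not> ?thesis"
    then have "eventually (\<lambda>n. ereal \<epsilon> \<le> ereal (real (block_complexity A X n) / (real n)\<^sup>2)) sequentially"
      unfolding eventually_sequentially by (intro exI[of _ "4 * c"]) (auto simp: not_less)
    then have "ereal \<epsilon> \<le> liminf (\<lambda>n. ereal (real (block_complexity A X n) / (real n)\<^sup>2))"
      by (rule Liminf_bounded)
    then show False using sub \<epsilon> by (simp add: subquadratic_growth_def)
  qed
  then obtain n where n: "4 * c \<le> n" "real (block_complexity A X n) / (real n)\<^sup>2 < \<epsilon>" by blast
  define T where "T = (n - 1) div c"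
  have n0: "0 < n" using n c by simp
  have T1: "c * T + 1 \<le> n" 
  proof -
    have "c * T \<le> n - 1" unfolding T_def by (rule times_div_less_eq_dividend)
    then show ?thesis using n0 by linarith
  qed
  have "n - 1 < c + c * T" unfolding T_def by (rule dividend_less_times_div) (use c in simp)
  then have T2: "n \<le> 2 * c * T" using n(1) by simp
  then have "1 \<le> T" using n0 by (cases T) auto
  have "real (block_complexity A X n) < \<epsilon> * (real n)\<^sup>2"
    using n(2) n0 by (simp add: divide_less_eq)
  also have "\<dots> \<le> \<epsilon> * (real (2 * c * T))\<^sup>2"
    using T2 \<epsilon> by (intro mult_left_mono power_mono) (auto simp del: of_nat_mult)
  also have "\<dots> = real (T\<^sup>2)" using c by (simp add: \<epsilon>_def power_mult_distrib)
  finally have "block_complexity A X n < T\<^sup>2" by simp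
  then show ?thesis using that \<open>1 \<le> T\<close> T1 by blast
qed

context subshift_automorphism
begin

text \<open>The bound on \<open>u\<close> in \<open>pointwise_relation\<close> does not depend on the point, so finitely many closed invariant
  sets \<open>Fx u\<close> cover \<open>X\<close>.\<close>

lemma ex_relation:
  assumes trans: "transitive_shift A X" and sub: "subquadratic_growth A X"
  obtains w :: "int \<times> int" where "w \<noteq> 0" "\<And>x. x \<in> X \<Longrightarrow> shift_pow (fst w) (iterate (snd w) x) = x"
proof -
  obtain r where r: "1 \<le> r" "has_radius X (iterate 1) r" "has_radius X (iterate (-1)) r"
    using ex_radius by blast
  interpret subshift_automorphism_radius A X \<phi> r
    by unfold_locales (use r in auto)
  obtain n T where T: "1 \<le> T" "nat (26 * (1 + r)) * T + 1 \<le> n" "block_complexity A X n < T\<^sup>2"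
  proof (rule subquadratic_few_words[OF sub])
    show "1 \<le> nat (26 * (1 + r))" using r by simp
  qed
  define m where "m = (1 + r) * int T"
  define K :: int where "K = fact (nat m)"
  have n: "26 * (1 + r) * int T + 1 \<le> int n"
  proof -
    have "int (nat (26 * (1 + r)) * T + 1) \<le> int n" using T(2) by (simp only: of_nat_le_iff)
    moreover have "int (nat (26 * (1 + r))) = 26 * (1 + r)" using r by simp
    ultimately show ?thesis by (simp only: of_nat_add of_nat_mult of_nat_1)
  qed
  have pt: "\<exists>u. u \<noteq> 0 \<and> wnorm r u \<le> m \<and> shift_pow (K * fst u) (iterate (K * snd u) x) = x" if "x \<in> X" for x
    using pointwise_relation[OF that _ n] T by (simp add: m_def K_def)
  define U where "U = {u. u \<noteq> 0 \<and> wnorm r u \<le> m}"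
  define Fx where "Fx u = {x \<in> X. shift_pow (K * fst u) (iterate (K * snd u) x) = x}" for u
  have "finite U"
  proof (rule finite_subset)
    show "U \<subseteq> {- m..m} \<times> {- m..m}"
    proof
      fix u assume "u \<in> U"
      then have u: "\<bar>fst u\<bar> + r * \<bar>snd u\<bar> \<le> m" by (simp add: U_def wnorm_def)
      have "1 * \<bar>snd u\<bar> \<le> r * \<bar>snd u\<bar>" using r by (intro mult_right_mono) auto
      then have "\<bar>fst u\<bar> \<le> m" "\<bar>snd u\<bar> \<le> m" using u by linarith+
      then show "u \<in> {- m..m} \<times> {- m..m}" by (auto simp: mem_Times_iff abs_le_iff)
    qed
  qed simp
  show ?thesis
  proof (cases "X = {}")
    case True
    then show ?thesis using that[of "(1, 0)"] by (simp add: zero_prod_def)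
  next
    case False
    have closed: "closedin (subshift_topology A X) (Fx u)" for u
    proof -
      have haus: "Hausdorff_space (full_shift A)"
        by (simp add: full_shift_def Hausdorff_space_product_topology)
      have "continuous_map (subshift_topology A X) (full_shift A) (iterate (K * snd u))"
        using iterate_continuous continuous_map_in_subtopology by blast
      from continuous_map_compose[OF this continuous_map_reindex[of A "\<lambda>i. i + K * fst u"]]
      have "continuous_map (subshift_topology A X) (full_shift A)
          (\<lambda>x. shift_pow (K * fst u) (iterate (K * snd u) x))"
        by (simp add: o_def shift_pow_apply)
      moreover have "continuous_map (subshift_topology A X) (full_shift A) (\<lambda>x. x)"
        using continuous_map_from_subtopology[OF continuous_map_id] by (simp add: id_def)
      ultimately have "closedin (subshift_topology A X)
          {x \<in> topspace (subshift_topology A X). shift_pow (K * fst u) (iterate (K * snd u) x) = x}"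
        by (rule closedin_continuous_maps_eq[OF haus])
      then show ?thesis unfolding topspace_subshift_topology[OF X] Fx_def .
    qed
    have invariant: "shift_pow k x \<in> Fx u" if "x \<in> Fx u" for x k u
    proof -
      have x: "x \<in> X" "shift_pow (K * fst u) (iterate (K * snd u) x) = x" using that by (auto simp: Fx_def)
      have "shift_pow (K * fst u) (iterate (K * snd u) (shift_pow k x))
          = shift_pow k (shift_pow (K * fst u) (iterate (K * snd u) x))"
        using x(1) by (simp add: iterate_shift_pow) (simp add: shift_pow_apply algebra_simps)
      then show ?thesis using x shift_pow_subshift[OF X] by (simp add: Fx_def)
    qed
    have "X \<subseteq> \<Union> (Fx ` U)" using pt by (auto simp: Fx_def U_def)
    then have "X \<in> Fx ` U"
      using closed invariant \<open>finite U\<close>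
      by (intro transitive_finite_closed_cover[OF X trans False]) auto
    then obtain u where u: "u \<in> U" "X = Fx u" by blast
    have "K \<noteq> 0" by (simp add: K_def)
    then have "zscale K u \<noteq> 0" using u(1) by (auto simp: U_def zscale_def prod_eq_iff)
    moreover have "shift_pow (K * fst u) (iterate (K * snd u) x) = x" if "x \<in> X" for x
      using that u(2) unfolding Fx_def by blast
    ultimately show ?thesis using that[of "zscale K u"] by (simp add: zscale_def)
  qed
qed

end

section \<open>Finite order modulo the shift\<close>

lemma finite_subshift_of_period:
  assumes "finite A" "subshift A X" "p \<noteq> 0" and per: "\<And>x. x \<in> X \<Longrightarrow> shift_pow p x = x"
  shows "finite X"
proof -
  have eq: "x i = x (i mod p)" if "x \<in> X" for x i
  proof -
    have s: "x (j + p) = x j" for j using per[OF that] by (metis shift_pow_apply)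
    have "x (j + int k * p) = x j" for j k using period_mult[of x p, OF s] .
    moreover have "x (j - int k * p) = x j" for j k
      using period_mult[of x p "j - int k * p" k, OF s] by simp
    ultimately have "x (j + int k * p) = x j" "x (j + - int k * p) = x j" for j k
      by simp_all
    then have "x (i mod p + (i div p) * p) = x (i mod p)"
      by (cases "i div p" rule: int_cases2) simp_all
    then show ?thesis by simp
  qed
  have "inj_on (\<lambda>x. restrict x {- \<bar>p\<bar>..\<bar>p\<bar>}) X"
  proof
    fix x y assume xy: "x \<in> X" "y \<in> X" "restrict x {- \<bar>p\<bar>..\<bar>p\<bar>} = restrict y {- \<bar>p\<bar>..\<bar>p\<bar>}"
    have "x i = y i" for i
    proof -
      have "i mod p \<in> {- \<bar>p\<bar>..\<bar>p\<bar>}" using abs_mod_less[OF assms(3), of i] by auto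
      then show ?thesis using eq xy restrict_apply' by metis
    qed
    then show "x = y" by blast
  qed
  moreover have "finite ((\<lambda>x. restrict x {- \<bar>p\<bar>..\<bar>p\<bar>}) ` X)"
  proof (rule finite_subset)
    have "X \<subseteq> UNIV \<rightarrow>\<^sub>E A"
      using assms(2) closedin_subset[of "full_shift A" X]
      by (simp add: subshift_def topspace_full_shift)
    then show "(\<lambda>x. restrict x {- \<bar>p\<bar>..\<bar>p\<bar>}) ` X \<subseteq> {- \<bar>p\<bar>..\<bar>p\<bar>} \<rightarrow>\<^sub>E A"
      by (auto simp: PiE_iff)
    show "finite ({- \<bar>p\<bar>..\<bar>p\<bar>} \<rightarrow>\<^sub>E A)" using assms(1) by (intro finite_PiE) auto
  qed
  ultimately show ?thesis by (rule finite_imageD[rotated])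
qed

lemma finite_Aut:
  assumes "finite X" "subshift A X" shows "finite (carrier (Aut A X))"
proof (rule finite_subset)
  show "carrier (Aut A X) \<subseteq> X \<rightarrow>\<^sub>E X"
  proof
    fix \<phi> assume \<phi>: "\<phi> \<in> carrier (Aut A X)"
    then have "\<phi> ` X = X"
      using homeomorphic_imp_surjective_map[of "subshift_topology A X" "subshift_topology A X" \<phi>]
      unfolding topspace_subshift_topology[OF assms(2)] by (simp add: Aut_def)
    then show "\<phi> \<in> X \<rightarrow>\<^sub>E X" using \<phi> by (auto simp: Aut_def PiE_iff)
  qed
  show "finite (X \<rightarrow>\<^sub>E X)" using assms(1) by (intro finite_PiE) auto
qed

lemma (in subshift_automorphism) iterate_in_shift_subgroup:
  assumes rel: "\<And>x. x \<in> X \<Longrightarrow> shift_pow p (iterate q x) = x"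
  shows "iterate q \<in> shift_subgroup A X"
proof -
  define s where "s = restrict shift X"
  have s_Aut: "s \<in> carrier (Aut A X)"
    unfolding s_def by (rule restrict_shift_in_Aut[OF X])
  interpret s: subshift_automorphism A X s
    by unfold_locales (rule A, rule X, rule s_Aut)
  have sp: "shift_pow 1 x = shift x" for x :: "int \<Rightarrow> 'a"
    by (simp add: shift_pow_apply shift_def[abs_def])
  have s1: "s.iterate 1 x = shift x" if "x \<in> X" for x
    using that group.int_pow_1[OF group_Aut[OF X] s_Aut]
    by (simp add: s.iterate_def) (simp add: s_def)
  have pow: "s.iterate k x = shift_pow k x" if "x \<in> X" for k x
    using that
  proof (induction k arbitrary: x rule: int_induct[where k = 0])
    case base
    then show ?case by (simp add: s.iterate_0 shift_pow_apply)
  next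
    case (step1 i)
    then show ?case
      using s.iterate_add[of x i 1] s1 shift_pow_subshift[OF X, of x 1]
      by (simp add: sp) (simp add: shift_pow_apply shift_def algebra_simps)
  next
    case (step2 i)
    define y where "y = shift_pow (-1) x"
    have y: "y \<in> X" "shift y = x"
      unfolding y_def using shift_pow_subshift[OF X step2.prems]
      by simp (simp add: shift_pow_apply shift_def)
    have "s.iterate (i - 1) x = s.iterate i y"
      using s.iterate_add[OF y(1), of "i - 1" 1] s1[OF y(1)] y(2) by simp
    also have "\<dots> = shift_pow (i - 1) x" using step2.IH[OF y(1)] by (simp add: y_def shift_pow_apply algebra_simps)
    finally show ?case .
  qed
  have "iterate q x = s.iterate (- p) x" for x
  proof (cases "x \<in> X")
    case True
    have "iterate q x = shift_pow (- p) (shift_pow p (iterate q x))" by (simp add: shift_pow_apply)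
    then show ?thesis using rel[OF True] pow[OF True] by simp
  next
    case False
    have "iterate q x = undefined" "s.iterate (- p) x = undefined"
      using False iterate_Aut[of q] s.iterate_Aut[of "- p"] by (auto simp: Aut_def extensional_def)
    then show ?thesis by simp
  qed
  then have "iterate q = s [^]\<^bsub>Aut A X\<^esub> (- p)" by (auto simp: s.iterate_def)
  then show ?thesis
    using group.generate_pow[OF group_Aut[OF X] s_Aut]
    unfolding shift_subgroup_def s_def[symmetric] by blast
qed

text \<open>If the common period \<open>w\<close> is horizontal, \<open>X\<close> is finite and a power of \<open>\<phi>\<close> is the identity; otherwise
  \<open>w\<close> expresses a nonzero power of \<open>\<phi>\<close> as a power of the shift.\<close>

lemma (in subshift_automorphism) power_in_shift_subgroup:
  assumes "transitive_shift A X" "subquadratic_growth A X"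
  obtains k :: nat where "0 < k" "\<phi> [^]\<^bsub>Aut A X\<^esub> k \<in> shift_subgroup A X"
proof -
  interpret G: group "Aut A X" by (rule group_Aut[OF X])
  interpret H: subgroup "shift_subgroup A X" "Aut A X"
    using shift_subgroup_normal[OF X] by (simp add: normal_def)
  obtain w :: "int \<times> int" where w: "w \<noteq> 0" "\<And>x. x \<in> X \<Longrightarrow> shift_pow (fst w) (iterate (snd w) x) = x"
    using ex_relation[OF assms] by blast
  show ?thesis
  proof (cases "snd w = 0")
    case True
    then have "fst w \<noteq> 0" using w(1) by (auto simp: prod_eq_iff)
    have "shift_pow (fst w) x = x" if "x \<in> X" for x
      using w(2)[OF that] that True by (simp add: iterate_0)
    then have "finite X" using finite_subshift_of_period[OF A X \<open>fst w \<noteq> 0\<close>] by blast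
    then have fin: "finite (carrier (Aut A X))" using finite_Aut X by blast
    have "\<phi> [^]\<^bsub>Aut A X\<^esub> order (Aut A X) = \<one>\<^bsub>Aut A X\<^esub>"
      by (rule G.pow_order_eq_1[OF \<phi>])
    then show ?thesis using that[of "order (Aut A X)"] G.order_gt_0_iff_finite fin by simp
  next
    case False
    have q: "iterate (snd w) \<in> shift_subgroup A X"
      using iterate_in_shift_subgroup[of "fst w" "snd w"] w(2) by blast
    have "\<phi> [^]\<^bsub>Aut A X\<^esub> \<bar>snd w\<bar> \<in> shift_subgroup A X"
    proof (cases "0 \<le> snd w")
      case True
      then show ?thesis using q by (simp add: iterate_def)
    next
      case neg: False
      then show ?thesis using H.m_inv_closed[OF q] \<phi> by (simp add: iterate_def G.int_pow_neg)
    qed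
    then have "\<phi> [^]\<^bsub>Aut A X\<^esub> nat \<bar>snd w\<bar> \<in> shift_subgroup A X"
      by (metis int_pow_int abs_ge_zero int_nat_eq)
    then show ?thesis using that[of "nat \<bar>snd w\<bar>"] False by simp
  qed
qed

theorem theorem1p1:
  fixes A :: "'a set" and X :: "(int \<Rightarrow> 'a) set"
  assumes "finite A"
    and "subshift A X"
    and "transitive_shift A X"
    and "subquadratic_growth A X"
  shows "periodic_group (Aut A X Mod shift_subgroup A X)"
proof -
  let ?G = "Aut A X" and ?H = "shift_subgroup A X"
  interpret group ?G by (rule group_Aut[OF assms(2)])
  interpret N: normal ?H ?G by (rule shift_subgroup_normal[OF assms(2)])
  have "\<exists>n::nat. n > 0 \<and> g [^]\<^bsub>?G Mod ?H\<^esub> n = \<one>\<^bsub>?G Mod ?H\<^esub>" if g: "g \<in> carrier (?G Mod ?H)" for g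
  proof -
    obtain \<phi> where rep: "\<phi> \<in> carrier ?G" "g = ?H #>\<^bsub>?G\<^esub> \<phi>"
      using g by (auto simp: FactGroup_def RCOSETS_def)
    interpret subshift_automorphism A X \<phi>
      by unfold_locales (use assms rep in auto)
    obtain k :: nat where k: "0 < k" "\<phi> [^]\<^bsub>?G\<^esub> k \<in> ?H"
      using power_in_shift_subgroup[OF assms(3,4)] by blast
    have "g [^]\<^bsub>?G Mod ?H\<^esub> k = ?H #>\<^bsub>?G\<^esub> (\<phi> [^]\<^bsub>?G\<^esub> k)"
      unfolding rep(2) by (rule N.FactGroup_pow[OF rep(1)])
    also have "\<dots> = ?H" using k(2) by (intro coset_join2) (auto simp: N.subgroup_axioms)
    finally show ?thesis using k(1) by (auto simp: FactGroup_def)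
  qed
  then show ?thesis using N.factorgroup_is_group by (simp add: periodic_group_def)
qed

end
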